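(* Consider the semi-Markov decision process model described in the context. For any two stationary randomized policies $\pi_1$ and $\pi_2$, the following bound on the difference of their long-run average costs holds: $$\eta_{\pi_2}-\eta_{\pi_1}\le\frac1{\overline m_{\pi_2}}\,\mathbb E_{x\sim d_{\pi_1},\,a\sim\pi_1(\cdot|x)}\left[\frac{\pi_2(a|x)}{\pi_1(a|x)}A_{\pi_1}(x,a)\right]+2\,\epsilon_{\pi_2}\,\tau_1[D_{\pi_2}]\ \mathbb E_{x\sim d_{\pi_1}}\left[\mathrm{TV}\big(\pi_2(\cdot|x)\,\|\,\pi_1(\cdot|x)\big)\right],$$ where $D_{\pi_2}$ is the group inverse of the matrix $I-P_{\pi_2}$ and $\epsilon_{\pi_2}=\frac1{\overline m_{\pi_2}}\max_{x\in\mathcal X}\big|\mathbb E_{a\sim\pi_2(\cdot|x)}[A_{\pi_1}(x,a)]\big|$.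
   Context: Semi-Markov decision process (SMDP): finite state space $\mathcal X$, action set $\mathcal A$. At a decision epoch in state $x$, action $a$ is chosen; $F(t|x,a)$ is the probability that the next decision epoch occurs within $t$ time units, and $P(y|x,a)$ is the probability that the state at the next decision epoch is $y$ (transition kernel of the embedded Markov decision process). It is assumed that there exist $\epsilon,\delta>0$ with $F(\delta|x,a)\le1-\epsilon$ for all $(x,a)$. The expected time to the next decision epoch is $m(x,a)=\int_0^\infty(1-F(s|x,a))\,ds$. The expected cost accumulated between consecutive decision epochs is $g(x,a)=k(x,a)+\mathbb E[\int_0^{\tau_1}c(x^{(t)},x,a)\,dt\mid x^{(0)}=x,a^{(0)}=a]$, where $k$ is an instantaneous cost, $c(y,x,a)$ is the cost rate while the natural process occupies $y$ after action $a$ was chosen in $x$ at the preceding decision epoch, and $\tau_1$ is the time until the next decision epoch. For a stationary randomized policy $\pi$: $P_\pi(x,y)=P_\pi(y|x)=\sum_{a}\pi(a|x)P(y|x,a)$, $m_\pi(x)=\sum_am(x,a)\pi(a|x)$, $g_\pi(x)=\sum_ag(x,a)\pi(a|x)$. It is assumed that for every stationary policy the embedded Markov chain has a unichain transition matrix $P_\pi$; $d_\pi$ is its stationary distribution and $\overline m_\pi=\mathbb E_{x\sim d_\pi}[m_\pi(x)]$ is the mean time between decision epochs. With $t_0=0,t_1,t_2,\dots$ the decision epochs and $\tau_k=t_{k+1}-t_k$ distributed according to $F(\cdot|x^{(t_k)},a^{(t_k)})$, the long-run average cost is $$\eta_\pi=\lim_{N\to\infty}\frac{\mathbb E_\pi[\sum_{k=0}^Ng(x^{(t_k)},a^{(t_k)})\mid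 x^{(0)}\sim\mu]}{\mathbb E_\pi[\sum_{k=0}^N\tau_k\mid x^{(0)}\sim\mu]},$$ which does not depend on the initial distribution $\mu$. The function $h_\pi(x)=\sum_{k=0}^\infty\mathbb E_\pi[g_\pi(x^{(t_k)})-\eta_\pi m_\pi(x^{(t_k)})\mid x^{(0)}=x]$ is a solution of the Poisson equation $h(x)=g_\pi(x)-\eta_\pi m_\pi(x)+\sum_{y\in\mathcal X}P_\pi(y|x)h(y)$, $x\in\mathcal X$. The advantage function is $A_\pi(x,a)=g(x,a)-\eta_\pi m(x,a)+\sum_{y\in\mathcal X}P(y|x,a)h_\pi(y)-h_\pi(x)$. The group inverse $D$ of a matrix $A$ is the unique matrix with $ADA=A$, $DAD=D$, $DA=AD$; the one-norm ergodicity coefficient is $\tau_1[A]=\max\{\|A^Tx\|_1:\|x\|_1=1,\ x^Te=0\}$, with $e$ the all-ones vector; $\mathrm{TV}(\pi_2(\cdot|x)\|\pi_1(\cdot|x))=\frac12\sum_{a\in\mathcal A}|\pi_2(a|x)-\pi_1(a|x)|$.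
   Formalization: Adds that wherever d_{π1}(x)>0, every action with π2(a|x)>0 has π1(a|x)>0 (otherwise the ratio term drops actions and the bound can fail); also requires that the series for h_{π1} converges and the sums m_π, g_π converge absolutely. *)

theory Defs
  imports "HOL-Probability.Probability"
begin

section \<open>Semi-Markov decision processes\<close>

text \<open>
  The state space is the finite type \<open>'x\<close>, the action set is the (not necessarily finite) discrete
  type \<open>'a\<close>.  After action \<open>a\<close> has been chosen in state \<open>x\<close> at a decision epoch, the evolution up to
  the next decision epoch is described by the probability space \<open>cycle_law x a\<close>: for an outcome
  \<open>w\<close>, the next decision epoch occurs after \<open>sojourn w\<close> time units, and \<open>nat_proc t w\<close> is the state of
  the natural process \<open>t\<close> time units after the decision.  The sojourn time and the state at the next
  decision epoch may be dependent.  \<open>cost_rate y x a\<close> is the cost rate while the natural process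
  occupies \<open>y\<close>.
\<close>

record ('x, 'a, 'w) smdp =
  cycle_law :: "'x \<Rightarrow> 'a \<Rightarrow> 'w measure"
  nat_proc :: "real \<Rightarrow> 'w \<Rightarrow> 'x"
  sojourn :: "'w \<Rightarrow> real"
  inst_cost :: "'x \<Rightarrow> 'a \<Rightarrow> real"
  cost_rate :: "'x \<Rightarrow> 'x \<Rightarrow> 'a \<Rightarrow> real"

type_synonym ('x, 'a) policy = "'x \<Rightarrow> 'a pmf"

definition next_state :: "('x, 'a, 'w) smdp \<Rightarrow> 'w \<Rightarrow> 'x" where
  "next_state S w = nat_proc S (sojourn S w) w"

definition epoch_cdf :: "('x, 'a, 'w) smdp \<Rightarrow> real \<Rightarrow> 'x \<Rightarrow> 'a \<Rightarrow> real" where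
  "epoch_cdf S t x a = measure (cycle_law S x a) {w \<in> space (cycle_law S x a). sojourn S w \<le> t}"

definition next_prob :: "('x, 'a, 'w) smdp \<Rightarrow> 'x \<Rightarrow> 'a \<Rightarrow> 'x \<Rightarrow> real" where
  "next_prob S x a y = measure (cycle_law S x a) {w \<in> space (cycle_law S x a). next_state S w = y}"

definition mean_time :: "('x, 'a, 'w) smdp \<Rightarrow> 'x \<Rightarrow> 'a \<Rightarrow> real" where
  "mean_time S x a = (LINT s:{0..}|lborel. 1 - epoch_cdf S s x a)"

definition epoch_cost :: "('x, 'a, 'w) smdp \<Rightarrow> 'x \<Rightarrow> 'a \<Rightarrow> real" where
  "epoch_cost S x a = inst_cost S x a +
     (LINT w|cycle_law S x a. (LINT t:{0..sojourn S w}|lborel. cost_rate S (nat_proc S t w) x a))"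

text \<open>
  The integrability condition says that \<open>mean_time\<close> is finite; the cost integral in \<open>epoch_cost\<close>
  is then absolutely convergent, since the state space is finite.
\<close>

definition is_smdp :: "('x::finite, 'a, 'w) smdp \<Rightarrow> bool" where
  "is_smdp S \<longleftrightarrow>
     (\<forall>x a. prob_space (cycle_law S x a) \<and>
        sojourn S \<in> borel_measurable (cycle_law S x a) \<and>
        (\<lambda>(t, w). nat_proc S t w) \<in> measurable (borel \<Otimes>\<^sub>M cycle_law S x a) (count_space UNIV) \<and>
        (AE w in cycle_law S x a. 0 \<le> sojourn S w) \<and>
        set_integrable lborel {0..} (\<lambda>s. 1 - epoch_cdf S s x a)) \<and>
     (\<exists>\<epsilon>>0. \<exists>\<delta>>0. \<forall>x a. epoch_cdf S \<delta> x a \<le> 1 - \<epsilon>)"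

section \<open>Stationary policies and the embedded chain\<close>

definition trans_mat :: "('x::finite, 'a, 'w) smdp \<Rightarrow> ('x, 'a) policy \<Rightarrow> real ^ 'x ^ 'x" where
  "trans_mat S \<pi> = (\<chi> x y. measure_pmf.expectation (\<pi> x) (\<lambda>a. next_prob S x a y))"

definition pol_time :: "('x, 'a, 'w) smdp \<Rightarrow> ('x, 'a) policy \<Rightarrow> 'x \<Rightarrow> real" where
  "pol_time S \<pi> x = measure_pmf.expectation (\<pi> x) (mean_time S x)"

definition pol_cost :: "('x, 'a, 'w) smdp \<Rightarrow> ('x, 'a) policy \<Rightarrow> 'x \<Rightarrow> real" where
  "pol_cost S \<pi> x = measure_pmf.expectation (\<pi> x) (epoch_cost S x)"

text \<open>
  Absolute convergence of the sums over the actions in \<open>pol_time\<close> and \<open>pol_cost\<close>; it holds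
  automatically for a finite action set.
\<close>

definition has_means :: "('x, 'a, 'w) smdp \<Rightarrow> ('x, 'a) policy \<Rightarrow> bool" where
  "has_means S \<pi> \<longleftrightarrow>
     (\<forall>x. integrable (measure_pmf (\<pi> x)) (mean_time S x) \<and>
          integrable (measure_pmf (\<pi> x)) (epoch_cost S x))"

definition reach :: "real ^ 'x ^ 'x \<Rightarrow> ('x::finite \<times> 'x) set" where
  "reach P = {(x, y). P $ x $ y > 0}\<^sup>*"

text \<open>
  A nonempty set that is exactly what can be reached from each of its elements is a closed
  communicating class; in a finite chain these are the recurrent classes.  States outside
  the unique recurrent class of a unichain matrix are transient.
\<close>

definition recurrent_class :: "real ^ 'x ^ 'x \<Rightarrow> 'x::finite set \<Rightarrow> bool" where
  "recurrent_class P C \<longleftrightarrow> C \<noteq> {} \<and> (\<forall>x\<in>C. reach P `` {x} = C)"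

definition unichain :: "real ^ 'x ^ 'x \<Rightarrow> bool" where
  "unichain P \<longleftrightarrow> (\<exists>!C. recurrent_class P (C :: 'x::finite set))"

definition stat_dist :: "real ^ 'x ^ 'x \<Rightarrow> real ^ 'x::finite" where
  "stat_dist P = (THE d. (\<forall>x. 0 \<le> d $ x) \<and> (\<Sum>x\<in>UNIV. d $ x) = 1 \<and> d v* P = d)"

definition mean_epoch :: "('x::finite, 'a, 'w) smdp \<Rightarrow> ('x, 'a) policy \<Rightarrow> real" where
  "mean_epoch S \<pi> = (\<Sum>x\<in>UNIV. stat_dist (trans_mat S \<pi>) $ x * pol_time S \<pi> x)"

section \<open>The controlled process\<close>

text \<open>
  The trajectory space consists of the sequences \<open>\<omega>\<close> with
  \<open>\<omega> k = (x, a, t, y)\<close>: state and action at the \<open>k\<close>-th decision epoch, time to the next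
  decision epoch, state at the next decision epoch.  Its law is the Ionescu-Tulcea measure.
\<close>

type_synonym ('x, 'a) epoch = "'x \<times> 'a \<times> real \<times> 'x"

definition epoch_space :: "('x, 'a) epoch measure" where
  "epoch_space = count_space UNIV \<Otimes>\<^sub>M (count_space UNIV \<Otimes>\<^sub>M (borel \<Otimes>\<^sub>M count_space UNIV))"

definition epoch_law ::
    "('x, 'a, 'w) smdp \<Rightarrow> ('x, 'a) policy \<Rightarrow> 'x pmf \<Rightarrow> ('x, 'a) epoch measure" where
  "epoch_law S \<pi> \<mu> =
     measure_pmf \<mu> \<bind> (\<lambda>x. measure_pmf (\<pi> x) \<bind> (\<lambda>a.
       distr (cycle_law S x a) epoch_space (\<lambda>w. (x, a, sojourn S w, next_state S w))))"

fun epoch_kernel ::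
    "('x, 'a, 'w) smdp \<Rightarrow> ('x, 'a) policy \<Rightarrow> 'x pmf \<Rightarrow> nat \<Rightarrow> (nat \<Rightarrow> ('x, 'a) epoch) \<Rightarrow>
      ('x, 'a) epoch measure" where
  "epoch_kernel S \<pi> \<mu> 0 \<omega> = epoch_law S \<pi> \<mu>"
| "epoch_kernel S \<pi> \<mu> (Suc k) \<omega> =
     (case \<omega> k of (x, a, t, y) \<Rightarrow> epoch_law S \<pi> (return_pmf y))"

definition traj_law ::
    "('x, 'a, 'w) smdp \<Rightarrow> ('x, 'a) policy \<Rightarrow> 'x pmf \<Rightarrow> (nat \<Rightarrow> ('x, 'a) epoch) measure" where
  "traj_law S \<pi> \<mu> =
     projective_family.lim UNIV
       (Ionescu_Tulcea.CI (epoch_kernel S \<pi> \<mu>) (\<lambda>_. epoch_space)) (\<lambda>_. epoch_space)"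

definition state_at :: "(nat \<Rightarrow> ('x, 'a) epoch) \<Rightarrow> nat \<Rightarrow> 'x" where
  "state_at \<omega> k = fst (\<omega> k)"

definition action_at :: "(nat \<Rightarrow> ('x, 'a) epoch) \<Rightarrow> nat \<Rightarrow> 'a" where
  "action_at \<omega> k = fst (snd (\<omega> k))"

definition time_at :: "(nat \<Rightarrow> ('x, 'a) epoch) \<Rightarrow> nat \<Rightarrow> real" where
  "time_at \<omega> k = fst (snd (snd (\<omega> k)))"

lemma bind_measure_pmf_in_prob_algebra:
  assumes "\<And>x. f x \<in> space (prob_algebra N)"
  shows "measure_pmf p \<bind> f \<in> space (prob_algebra N)"
proof -
  have p: "measure_pmf p \<in> space (prob_algebra (count_space UNIV))"
    by (simp add: space_prob_algebra prob_space_measure_pmf)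
  have f: "f \<in> measurable (count_space UNIV) (prob_algebra N)"
    using assms by auto
  show ?thesis
    using prob_space_bind'[OF p f] sets_bind'[OF p f] by (simp add: space_prob_algebra)
qed

lemma prob_space_epoch_law:
  assumes "is_smdp S"
  shows "epoch_law S \<pi> \<mu> \<in> space (subprob_algebra epoch_space)"
    and "prob_space (epoch_law S \<pi> \<mu>)"
proof -
  have ns: "next_state S \<in> measurable (cycle_law S x a) (count_space UNIV)" for x a
  proof -
    have [measurable]: "sojourn S \<in> borel_measurable (cycle_law S x a)"
      and p: "(\<lambda>(t, w). nat_proc S t w) \<in>
        measurable (borel \<Otimes>\<^sub>M cycle_law S x a) (count_space UNIV)"
      using assms by (auto simp: is_smdp_def)
    have "(\<lambda>w. (sojourn S w, w)) \<in> measurable (cycle_law S x a) (borel \<Otimes>\<^sub>M cycle_law S x a)"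
      by measurable
    from measurable_compose[OF this p] show ?thesis
      by (simp add: next_state_def[abs_def])
  qed
  have m: "(\<lambda>w. (x, a, sojourn S w, next_state S w)) \<in> measurable (cycle_law S x a) epoch_space" for x a
    using assms ns unfolding epoch_space_def is_smdp_def by (intro measurable_Pair) auto
  have d: "distr (cycle_law S x a) epoch_space (\<lambda>w. (x, a, sojourn S w, next_state S w))
      \<in> space (prob_algebra epoch_space)" for x a
    using assms m[of x a] by (auto simp: space_prob_algebra is_smdp_def intro!: prob_space.prob_space_distr)
  have "epoch_law S \<pi> \<mu> \<in> space (prob_algebra epoch_space)"
    unfolding epoch_law_def by (intro bind_measure_pmf_in_prob_algebra d)
  then show "epoch_law S \<pi> \<mu> \<in> space (subprob_algebra epoch_space)" "prob_space (epoch_law S \<pi> \<mu>)"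
    by (auto simp: space_prob_algebra space_subprob_algebra prob_space_imp_subprob_space)
qed

lemma Ionescu_Tulcea_epoch_kernel:
  assumes "is_smdp S"
  shows "Ionescu_Tulcea (epoch_kernel S \<pi> \<mu>) (\<lambda>_. epoch_space)"
proof (rule Ionescu_Tulcea.intro)
  fix k
  show "epoch_kernel S \<pi> \<mu> k \<in> measurable (PiM {0..<k} (\<lambda>_. epoch_space)) (subprob_algebra epoch_space)"
  proof (cases k)
    case 0
    then show ?thesis
      using prob_space_epoch_law(1)[OF assms] by (simp add: epoch_kernel.simps(1)[abs_def])
  next
    case (Suc i)
    have 1: "(\<lambda>\<omega>. \<omega> i) \<in> measurable (PiM {0..<Suc i} (\<lambda>_. epoch_space)) epoch_space"
      by (rule measurable_component_singleton) simp
    have 2: "(\<lambda>e. snd (snd (snd e))) \<in> measurable epoch_space (count_space UNIV)"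
      unfolding epoch_space_def by measurable
    have 3: "(\<lambda>y. epoch_law S \<pi> (return_pmf y)) \<in>
        measurable (count_space UNIV) (subprob_algebra epoch_space)"
      using prob_space_epoch_law(1)[OF assms] by auto
    have "epoch_kernel S \<pi> \<mu> (Suc i) = (\<lambda>\<omega>. epoch_law S \<pi> (return_pmf (snd (snd (snd (\<omega> i))))))"
      by (auto split: prod.splits)
    with measurable_compose[OF measurable_compose[OF 1 2] 3] Suc show ?thesis
      by simp
  qed
next
  fix k \<omega>
  show "prob_space (epoch_kernel S \<pi> \<mu> k \<omega>)"
    using prob_space_epoch_law(2)[OF assms] by (cases k) (auto split: prod.splits)
qed

lemma
  assumes "is_smdp S"
  shows prob_space_traj_law: "prob_space (traj_law S \<pi> \<mu>)"
    and sets_traj_law: "sets (traj_law S \<pi> \<mu>) = sets (PiM UNIV (\<lambda>_. epoch_space))"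
proof -
  interpret IT: Ionescu_Tulcea "epoch_kernel S \<pi> \<mu>" "\<lambda>_. epoch_space"
    by (rule Ionescu_Tulcea_epoch_kernel[OF assms])
  show "sets (traj_law S \<pi> \<mu>) = sets (PiM UNIV (\<lambda>_. epoch_space))"
    unfolding traj_law_def by simp
  have "prob_space (distr IT.PF.lim (PiM {} (\<lambda>_. epoch_space)) (\<lambda>\<omega>. restrict \<omega> {}))"
    by (simp add: IT.distr_lim IT.PF.prob_space_P)
  then show "prob_space (traj_law S \<pi> \<mu>)"
    unfolding traj_law_def by (rule prob_space_distrD[rotated])
      (simp add: measurable_cong_sets[OF IT.PF.sets_lim refl] measurable_restrict)
qed

section \<open>Average cost, relative values and advantages\<close>

text \<open>
  The long-run average cost is the common value of the limit for all initial distributions.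
\<close>

definition avg_cost :: "('x, 'a, 'w) smdp \<Rightarrow> ('x, 'a) policy \<Rightarrow> real" where
  "avg_cost S \<pi> = (THE r. \<forall>\<mu>.
     (\<lambda>N. (LINT \<omega>|traj_law S \<pi> \<mu>. (\<Sum>k\<le>N. epoch_cost S (state_at \<omega> k) (action_at \<omega> k))) /
          (LINT \<omega>|traj_law S \<pi> \<mu>. (\<Sum>k\<le>N. time_at \<omega> k))) \<longlonglongrightarrow> r)"

definition rel_term :: "('x, 'a, 'w) smdp \<Rightarrow> ('x, 'a) policy \<Rightarrow> 'x \<Rightarrow> nat \<Rightarrow> real" where
  "rel_term S \<pi> x k = (LINT \<omega>|traj_law S \<pi> (return_pmf x).
     pol_cost S \<pi> (state_at \<omega> k) - avg_cost S \<pi> * pol_time S \<pi> (state_at \<omega> k))"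

definition rel_value :: "('x, 'a, 'w) smdp \<Rightarrow> ('x, 'a) policy \<Rightarrow> 'x \<Rightarrow> real" where
  "rel_value S \<pi> x = (\<Sum>k. rel_term S \<pi> x k)"

definition advantage :: "('x::finite, 'a, 'w) smdp \<Rightarrow> ('x, 'a) policy \<Rightarrow> 'x \<Rightarrow> 'a \<Rightarrow> real" where
  "advantage S \<pi> x a = epoch_cost S x a - avg_cost S \<pi> * mean_time S x a +
     (\<Sum>y\<in>UNIV. next_prob S x a y * rel_value S \<pi> y) - rel_value S \<pi> x"

section \<open>Ergodicity coefficient, group inverse, total variation\<close>

definition group_inv :: "real ^ 'x ^ 'x \<Rightarrow> real ^ 'x ^ 'x::finite" where
  "group_inv A = (THE D. A ** D ** A = A \<and> D ** A ** D = D \<and> D ** A = A ** D)"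

definition norm1 :: "real ^ 'x::finite \<Rightarrow> real" where
  "norm1 v = (\<Sum>i\<in>UNIV. \<bar>v $ i\<bar>)"

text \<open>
  The set of admissible vectors is empty when there is only one state; inserting \<open>0\<close> fixes
  the maximum over the empty set as \<open>0\<close> and has no effect otherwise.
\<close>

definition erg_coeff :: "real ^ 'x ^ 'x \<Rightarrow> real" where
  "erg_coeff A = Sup (insert 0
     {norm1 (transpose A *v v) | v :: real ^ 'x::finite. norm1 v = 1 \<and> (\<Sum>i\<in>UNIV. v $ i) = 0})"

definition tv_dist :: "'a pmf \<Rightarrow> 'a pmf \<Rightarrow> real" where
  "tv_dist p q = (\<Sum>\<^sub>\<infinity>a. \<bar>pmf p a - pmf q a\<bar>) / 2"

definition eps_coeff ::
    "('x::finite, 'a, 'w) smdp \<Rightarrow> ('x, 'a) policy \<Rightarrow> ('x, 'a) policy \<Rightarrow> real" where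
  "eps_coeff S \<pi>\<^sub>1 \<pi>\<^sub>2 = 1 / mean_epoch S \<pi>\<^sub>2 *
     Max (range (\<lambda>x. \<bar>measure_pmf.expectation (\<pi>\<^sub>2 x) (advantage S \<pi>\<^sub>1 x)\<bar>))"

end

theory Submission
  imports Defs
begin

text \<open>
  Let \<open>B x\<close> be the expectation of \<open>A\<^bsub>\<pi>\<^sub>1\<^esub>(x, \<cdot>)\<close> under \<open>\<pi>\<^sub>2\<close>, and \<open>d\<^sub>1, d\<^sub>2\<close> the stationary distributions.
  Integrating \<open>B\<close> against \<open>d\<^sub>2\<close> cancels the relative values and gives the mean epoch length of
  \<open>\<pi>\<^sub>2\<close> times the cost difference.  Replacing \<open>d\<^sub>2\<close> by \<open>d\<^sub>1\<close> yields the importance-weighted term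
  with an error of at most \<open>max \<bar>B\<bar>\<close> times the 1-norm of \<open>d\<^sub>2 - d\<^sub>1 = d\<^sub>1 (P\<^sub>2 - P\<^sub>1) D\<^sub>2\<close>.  The row
  \<open>d\<^sub>1 (P\<^sub>2 - P\<^sub>1)\<close> sums to zero and its 1-norm is at most twice the mean total variation distance
  of the policies, so the ergodicity coefficient of \<open>D\<^sub>2\<close> applies.
\<close>

section \<open>Distributivity of matrix products and signs\<close>

lemma matrix_diff_ldistrib:
  fixes A :: "'a::ring_1 ^ 'm ^ 'n"
  shows "A ** (B - C) = A ** B - A ** C"
  by (simp add: matrix_matrix_mult_def vec_eq_iff algebra_simps sum_subtractf)

lemma matrix_diff_rdistrib:
  fixes A B :: "'a::ring_1 ^ 'm ^ 'n"
  shows "(A - B) ** C = A ** C - B ** C"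
  by (simp add: matrix_matrix_mult_def vec_eq_iff algebra_simps sum_subtractf)

lemma matrix_add_rdistrib:
  fixes A B :: "'a::semiring_1 ^ 'm ^ 'n"
  shows "(A + B) ** C = A ** C + B ** C"
  by (simp add: matrix_matrix_mult_def vec_eq_iff algebra_simps sum.distrib)

lemma vector_matrix_uminus:
  fixes A :: "'a::comm_ring_1 ^ 'm ^ 'n"
  shows "(- v) v* A = - (v v* A)"
  by (simp add: vector_matrix_mult_def vec_eq_iff sum_negf)

section \<open>Stochastic matrices\<close>

locale stochastic_matrix =
  fixes P :: "real ^ 'x ^ 'x::finite"
  assumes nonneg: "0 \<le> P $ x $ y"
    and row_sum: "(\<Sum>y\<in>UNIV. P $ x $ y) = 1"
begin

lemma mult_component: "(P *v v) $ x = (\<Sum>y\<in>UNIV. P $ x $ y * v $ y)"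
  by (simp add: matrix_vector_mult_def)

text \<open>Because each row sums to one, the gap to \<open>c\<close> is itself averaged by
  \<open>P\<close>. Nonnegative gaps then yield the order bounds and the maximum principle.\<close>

lemma mult_diff_const: "(\<Sum>y\<in>UNIV. P $ x $ y * (c - v $ y)) = c - (P *v v) $ x"
  by (simp add: mult_component algebra_simps sum_subtractf row_sum flip: sum_distrib_left)

lemma mult_le: "(P *v v) $ x \<le> c" if "\<And>y. v $ y \<le> c"
  using mult_diff_const[of x c v] that
  by (smt (verit) nonneg sum_nonneg mult_nonneg_nonneg)

lemma mult_uminus: "(P *v (- v)) = - (P *v v)"
  by (metis matrix_vector_mult_diff_distrib diff_0 matrix_vector_mult_0_right)

lemma mult_ge: "c \<le> (P *v v) $ x" if "\<And>y. c \<le> v $ y"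
  using mult_le[of "- v" "- c" x] that by (simp add: mult_uminus)

lemma mult_const: "P *v vec c = vec c"
  by (simp add: vec_eq_iff mult_component row_sum flip: sum_distrib_right)

text \<open>\<open>mult_le\<close> and \<open>mult_ge\<close> keep every entry between
  \<open>- norm1 v\<close> and \<open>norm1 v\<close>. A bound uniform in \<open>k\<close> is all
  that the Cesaro remainder requires.\<close>

lemma abs_power_mult_le: "\<bar>(((*v) P ^^ k) v) $ x\<bar> \<le> norm1 v"
proof (induction k arbitrary: x)
  case 0
  show ?case
    unfolding norm1_def by (auto intro: member_le_sum[of x UNIV "\<lambda>i. \<bar>v $ i\<bar>"])
next
  case (Suc k)
  then show ?case
    using mult_le[of "((*v) P ^^ k) v" "norm1 v" x] mult_ge[of "- norm1 v" "((*v) P ^^ k) v" x]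
    by (auto simp: abs_le_iff) (smt (verit))+
qed

lemma power_mult_const: "((*v) P ^^ k) (vec c) = vec c"
  by (induction k) (simp_all add: mult_const)

lemma power_mult_add: "((*v) P ^^ k) (v + w) = ((*v) P ^^ k) v + ((*v) P ^^ k) w"
  by (induction k) (simp_all add: matrix_vector_right_distrib)

lemma sum_power_mult_telescope:
  "(\<Sum>k<N. ((*v) P ^^ k) (w - P *v w)) = w - ((*v) P ^^ N) w"
proof -
  have "((*v) P ^^ k) (w - P *v w) = ((*v) P ^^ k) w - ((*v) P ^^ Suc k) w" for k
    by (induction k) (simp_all add: matrix_vector_mult_diff_distrib)
  then show ?thesis
    using sum_lessThan_telescope'[of "\<lambda>k. ((*v) P ^^ k) w" N] by simp
qed

text \<open>At a maximum of \<open>v\<close>, \<open>P v = v\<close> makes \<open>v\<close> an average of values not exceeding it.\<close>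

lemma harmonic_max_closed:
  assumes "P *v v = v" "\<And>y. v $ y \<le> c"
  shows "reach P `` {x. v $ x = c} \<subseteq> {x. v $ x = c}"
proof -
  have step: "v $ y = c" if "v $ x = c" "0 < P $ x $ y" for x y
  proof -
    have "(\<Sum>y\<in>UNIV. P $ x $ y * (c - v $ y)) = 0"
      using mult_diff_const[of x c v] assms(1) that by simp
    then have "P $ x $ y * (c - v $ y) = 0"
      using assms(2) nonneg by (subst (asm) sum_nonneg_eq_0_iff) (auto simp del: mult_eq_0_iff)
    with that show ?thesis by simp
  qed
  have "v $ y = c" if "(x, y) \<in> reach P" "v $ x = c" for x y
    using that(1)[unfolded reach_def] by (induction rule: rtrancl_induct) (use that(2) step in auto)
  then show ?thesis by auto
qed

end

text \<open>A state of \<open>A\<close> with the fewest reachable states generates the class: any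
  state that it reaches has a reachable set contained in its own and, by minimality, no smaller,
  hence equal.\<close>

lemma recurrent_class_in_closed:
  assumes "A \<noteq> {}" "reach P `` A \<subseteq> A"
  obtains C where "C \<subseteq> A" "recurrent_class P C"
proof -
  define x where "x = arg_min_on (\<lambda>x. card (reach P `` {x})) A"
  have x: "x \<in> A" and min: "\<And>y. y \<in> A \<Longrightarrow> card (reach P `` {x}) \<le> card (reach P `` {y})"
    using assms(1) unfolding x_def
    by (auto intro: arg_min_if_finite arg_min_least)
  have "reach P `` {y} = reach P `` {x}" if "y \<in> reach P `` {x}" for y
  proof (rule card_subset_eq)
    show sub: "reach P `` {y} \<subseteq> reach P `` {x}"
      using that by (auto simp: reach_def)
    have "y \<in> A" using that x assms(2) by auto
    with min[of y] card_mono[OF _ sub] show "card (reach P `` {y}) = card (reach P `` {x})"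
      by auto
  qed auto
  moreover have "x \<in> reach P `` {x}" by (auto simp: reach_def)
  ultimately have "recurrent_class P (reach P `` {x})"
    unfolding recurrent_class_def by blast
  moreover have "reach P `` {x} \<subseteq> A" using x assms(2) by blast
  ultimately show ?thesis by (rule that[rotated])
qed

section \<open>Unichain matrices: Poisson equation, stationary distribution, Cesaro limits\<close>

locale unichain_matrix = stochastic_matrix +
  assumes unichain: "unichain P"
begin

text \<open>The maximum set and the minimum set of \<open>v\<close> are both closed, so each
  contains a recurrent class. There is only one such class, so the two sets meet and the extreme
  values agree.\<close>

lemma harmonic_const:
  assumes "P *v v = v"
  shows "v = vec (v $ x)"
proof -
  define a where "a = Max (range (($) v))"
  define b where "b = Min (range (($) v))"
  have a: "v $ y \<le> a" and b: "b \<le> v $ y" for y by (auto simp: a_def b_def)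
  have "a \<in> range (($) v)" "b \<in> range (($) v)"
    unfolding a_def b_def by (auto intro: Max_in Min_in)
  then have ne: "{x. v $ x = a} \<noteq> {}" "{x. v $ x = b} \<noteq> {}" by auto
  \<comment> \<open>Minima of \<open>v\<close> are maxima of \<open>- v\<close>.\<close>
  have "P *v - v = - v" by (simp add: assms mult_uminus)
  with harmonic_max_closed[of "- v" "- b"] b
  have "reach P `` {x. v $ x = b} \<subseteq> {x. v $ x = b}" by simp
  from recurrent_class_in_closed[OF ne(2) this] obtain C' where
    C': "C' \<subseteq> {x. v $ x = b}" "recurrent_class P C'" by blast
  from recurrent_class_in_closed[OF ne(1) harmonic_max_closed[OF assms a]] obtain C where
    C: "C \<subseteq> {x. v $ x = a}" "recurrent_class P C" by blast
  have "C = C'" using C C' unichain unfolding unichain_def by blast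
  moreover have "C \<noteq> {}" using C by (simp add: recurrent_class_def)
  ultimately have "a = b" using C C' by auto
  with a b have "v $ y = a" for y by (metis order_antisym)
  then show ?thesis by (simp add: vec_eq_iff)
qed

text \<open>Evaluate at a maximum and at a minimum of \<open>w\<close>.\<close>

lemma poisson_sign:
  obtains x y where "0 \<le> (w - P *v w) $ x" "(w - P *v w) $ y \<le> 0"
proof -
  have "Max (range (($) w)) \<in> range (($) w)" "Min (range (($) w)) \<in> range (($) w)"
    by (auto intro: Max_in Min_in)
  then obtain x y where "w $ x = Max (range (($) w))" "w $ y = Min (range (($) w))"
    by (metis imageE)
  then have "\<And>z. w $ z \<le> w $ x" "\<And>z. w $ y \<le> w $ z" by auto
  from mult_le[OF this(1)] mult_ge[OF this(2)] that[of x y] show ?thesis by simp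
qed

text \<open>
  The map \<open>G w = (I - P) w + w\<^sub>x e\<close> is injective, hence surjective.  This solves the Poisson
  equation for every right-hand side without reference to a stationary distribution.
\<close>

lemma poisson_decomposition:
  obtains w c where "f = (w - P *v w) + vec c"
proof -
  obtain x :: 'a where True by simp
  define G where "G w = (w - P *v w) + vec (w $ x)" for w
  have lin: "linear G"
    unfolding G_def by (rule linearI)
      (simp_all add: vec_eq_iff matrix_vector_right_distrib matrix_vector_mult_scaleR algebra_simps)
  have "w = 0" if "G w = 0" for w
  proof -
    \<comment> \<open>The image of \<open>w\<close> under \<open>I - P\<close> is constant, and by
      \<open>poisson_sign\<close> such a constant is both at least and at most zero.\<close>
    have *: "(w - P *v w) $ y = - w $ x" for y
      using that by (simp add: G_def vec_eq_iff eq_neg_iff_add_eq_0)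
    from poisson_sign[of w] have "w $ x = 0"
      unfolding * by (metis neg_0_le_iff_le neg_le_0_iff_le antisym)
    moreover have "P *v w = w" using * \<open>w $ x = 0\<close> by (simp add: vec_eq_iff)
    ultimately show "w = 0" using harmonic_const[of w x] by (simp add: vec_eq_iff)
  qed
  then have "inj G" using lin by (simp add: linear_injective_0)
  with lin have "surj G" by (simp add: linear_injective_imp_surjective)
  then obtain w where "f = G w" by blast
  with that show ?thesis by (simp add: G_def)
qed

text \<open>The difference of the two solutions has a constant image under \<open>I - P\<close>,
  which \<open>poisson_sign\<close> forces to be zero. With \<open>poisson_decomposition\<close>
  this makes \<open>c\<close> a function of the right-hand side.\<close>

lemma poisson_const_unique:
  assumes "(w - P *v w) + vec c = (w' - P *v w') + vec c'"
  shows "c = c'"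
proof -
  have *: "((w - w') - P *v (w - w')) $ x = c' - c" for x
    using assms by (simp add: vec_eq_iff matrix_vector_mult_diff_distrib algebra_simps)
  from poisson_sign[of "w - w'"] show ?thesis unfolding * by force
qed

abbreviation "stationary d \<equiv> (\<forall>x. 0 \<le> d $ x) \<and> (\<Sum>x\<in>UNIV. d $ x) = 1 \<and> d v* P = d"

text \<open>A stationary \<open>d\<close> annihilates the range of \<open>I - P\<close>, so pairing
  with \<open>d\<close> extracts the constant of a Poisson decomposition.\<close>

lemma stationary_inner:
  assumes "stationary d"
  shows "d \<bullet> (w - P *v w + vec c) = c"
proof -
  have "d \<bullet> (P *v w) = d \<bullet> w"
    using assms by (simp flip: dot_lmul_matrix)
  moreover have "d \<bullet> vec c = c"
    using assms by (simp add: inner_vec_def flip: sum_distrib_right)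
  ultimately show ?thesis by (simp add: inner_add_right inner_diff_right)
qed

lemma stationary_unique:
  assumes "stationary d" "stationary d'"
  shows "d = d'"
proof -
  have "d \<bullet> f = d' \<bullet> f" for f
    using poisson_decomposition[of f] stationary_inner[OF assms(1)] stationary_inner[OF assms(2)]
    by metis
  then show ?thesis by (metis vector_eq_rdot)
qed

text \<open>The stationary distribution is built as the functional that sends \<open>f\<close> to
  its Poisson constant. Vectors \<open>w - P *v w\<close> have constant zero, which is invariance;
  \<open>vec 1\<close> has constant one, which is normalization.\<close>

lemma stationary_ex: "\<exists>d. stationary d"
proof -
  have "\<exists>p. f = (fst p - P *v fst p) + vec (snd p)" for f
    by (rule poisson_decomposition[of f]) auto
  then obtain p where p: "\<And>f. f = (fst (p f) - P *v fst (p f)) + vec (snd (p f))"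
    using choice[of "\<lambda>f p. f = (fst p - P *v fst p) + vec (snd p)"] by blast
  define W where "W = fst \<circ> p"
  define c where "c = snd \<circ> p"
  have Wc: "f = (W f - P *v W f) + vec (c f)" for f
    using p[of f] by (simp add: W_def c_def)
  \<comment> \<open>Any decomposition of \<open>f\<close> computes \<open>c f\<close>. Hence
    \<open>c\<close> is linear although the chosen solutions \<open>W\<close> need not be.\<close>
  have c: "c f = a" if "f = (w - P *v w) + vec a" for f w a
    by (rule poisson_const_unique[OF trans[OF Wc[symmetric] that]])
  have lin: "linear c"
  proof (rule linearI)
    fix f g
    have "f + g = ((W f + W g) - P *v (W f + W g)) + vec (c f + c g)"
      using arg_cong2[OF Wc[of f] Wc[of g], of "(+)"]
      by (simp add: vec_eq_iff matrix_vector_right_distrib add_diff_eq diff_add_eq)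
    then show "c (f + g) = c f + c g" by (rule c)
  next
    fix r f
    have "r *\<^sub>R f = (r *\<^sub>R W f - P *v (r *\<^sub>R W f)) + vec (r * c f)"
      using arg_cong[OF Wc[of f], of "\<lambda>v. r *\<^sub>R v"]
      by (simp add: vec_eq_iff matrix_vector_mult_scaleR distrib_left right_diff_distrib)
    then show "c (r *\<^sub>R f) = r *\<^sub>R c f" by (simp add: c)
  qed
  define d where "d = (\<chi> y. c (axis y 1))"
  have d: "d \<bullet> f = c f" for f
  proof -
    have "c f = c (\<Sum>y\<in>UNIV. f $ y *\<^sub>R axis y 1)"
      using basis_expansion[of f] by (simp add: scalar_mult_eq_scaleR)
    also have "\<dots> = (\<Sum>y\<in>UNIV. f $ y *\<^sub>R c (axis y 1))"
      by (simp add: linear_sum[OF lin] linear_scale[OF lin])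
    finally show ?thesis by (simp add: d_def inner_vec_def mult.commute)
  qed
  \<comment> \<open>At a state where the part \<open>W f - P *v W f\<close> is at most zero,
    \<open>f\<close> is at most \<open>c f\<close>.\<close>
  have nn: "0 \<le> c f" if "\<And>x. 0 \<le> f $ x" for f
  proof -
    obtain x where "(W f - P *v W f) $ x \<le> 0" using poisson_sign by metis
    moreover have "f $ x = (W f - P *v W f) $ x + c f"
      using Wc[of f] by (metis vector_add_component vec_component)
    ultimately show ?thesis using that[of x] by simp
  qed
  have "d v* P = d"
  proof -
    have "(d v* P) \<bullet> w = d \<bullet> w" for w
    proof -
      have "d \<bullet> (w - P *v w) = 0"
        unfolding d by (rule c[of _ w]) simp
      then show ?thesis by (simp add: dot_lmul_matrix inner_diff_right)
    qed
    then show ?thesis by (metis vector_eq_rdot)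
  qed
  moreover have "(\<Sum>x\<in>UNIV. d $ x) = 1"
  proof -
    have "d \<bullet> vec 1 = 1" unfolding d by (rule c[of _ 0]) simp
    then show ?thesis by (simp add: inner_vec_def)
  qed
  moreover have "0 \<le> d $ x" for x
    unfolding d_def by (simp add: nn axis_def)
  ultimately show ?thesis by blast
qed

lemma stationary_stat_dist: "stationary (stat_dist P)"
proof -
  have "\<exists>!d. stationary d"
    by (rule ex_ex1I[OF stationary_ex stationary_unique])
  then show ?thesis
    unfolding stat_dist_def by (rule theI')
qed

text \<open>The part of \<open>f\<close> in the range of \<open>I - P\<close> telescopes to a
  bounded boundary term, which disappears after division by \<open>Suc N\<close>. Only the constant
  survives, even where the powers of \<open>P\<close> oscillate.\<close>

lemma cesaro_limit:
  "(\<lambda>N. (\<Sum>k\<le>N. (((*v) P ^^ k) f) $ x) / real (Suc N)) \<longlonglongrightarrow> stat_dist P \<bullet> f"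
proof -
  obtain w c where f: "f = (w - P *v w) + vec c" by (rule poisson_decomposition)
  have c: "stat_dist P \<bullet> f = c"
    unfolding f by (rule stationary_inner[OF stationary_stat_dist])
  have sum: "(\<Sum>k\<le>N. (((*v) P ^^ k) f) $ x) = w $ x - (((*v) P ^^ Suc N) w) $ x + real (Suc N) * c" for N
  proof -
    have "(\<Sum>k<Suc N. ((*v) P ^^ k) f) = w - ((*v) P ^^ Suc N) w + (\<Sum>k<Suc N. vec c :: real ^ 'a)"
      unfolding f power_mult_add power_mult_const sum.distrib sum_power_mult_telescope ..
    then have "(\<Sum>k<Suc N. ((*v) P ^^ k) f) $ x = w $ x - (((*v) P ^^ Suc N) w) $ x + real (Suc N) * c"
      by (simp only: vector_add_component vector_minus_component sum_component vec_component sum_constant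
          card_lessThan vector_mult_component of_nat_index)
    then show ?thesis by (simp only: lessThan_Suc_atMost sum_component)
  qed
  have "(\<lambda>N. (w $ x - (((*v) P ^^ Suc N) w) $ x) / real (Suc N)) \<longlonglongrightarrow> 0"
  proof (rule Lim_null_comparison)
    show "\<forall>\<^sub>F N in sequentially. norm ((w $ x - (((*v) P ^^ Suc N) w) $ x) / real (Suc N))
        \<le> (2 * norm1 w) * inverse (real (Suc N))"
    proof (rule always_eventually, rule allI)
      fix N
      have "\<bar>w $ x\<bar> \<le> norm1 w"
        using abs_power_mult_le[of 0 w x] by simp
      with abs_power_mult_le[of "Suc N" w x]
      have "\<bar>w $ x - (((*v) P ^^ Suc N) w) $ x\<bar> \<le> 2 * norm1 w"
        by linarith
      then show "norm ((w $ x - (((*v) P ^^ Suc N) w) $ x) / real (Suc N))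
        \<le> (2 * norm1 w) * inverse (real (Suc N))"
        unfolding real_norm_def divide_inverse abs_mult by (simp only: abs_inverse abs_of_nat)
          (rule mult_right_mono, simp_all)
    qed
    show "(\<lambda>N. (2 * norm1 w) * inverse (real (Suc N))) \<longlonglongrightarrow> 0"
      using tendsto_mult_right_zero[OF LIMSEQ_inverse_real_of_nat] by simp
  qed
  from tendsto_add[OF this tendsto_const[of c]]
  show ?thesis
    unfolding sum c by (simp add: add_divide_distrib del: funpow.simps of_nat_Suc)
qed

end

section \<open>The group inverse and the ergodicity coefficient\<close>

text \<open>First \<open>A D = (A E A) D = (E A) (D A) = E A = A E\<close>; then
  \<open>D = D A D\<close> and \<open>E = E A E\<close> are both determined by this common product.
  This justifies the description operator in \<open>group_inv\<close>.\<close>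

lemma group_inverse_unique:
  fixes A :: "real ^ 'x ^ 'x::finite"
  assumes D: "A ** D ** A = A" "D ** A ** D = D" "D ** A = A ** D"
    and E: "A ** E ** A = A" "E ** A ** E = E" "E ** A = A ** E"
  shows "D = E"
proof -
  have eq: "A ** D = A ** E"
    by (metis D(1,3) E(1,3) matrix_mul_assoc)
  then show ?thesis
    by (metis D(2,3) E(2,3) matrix_mul_assoc)
qed

text \<open>The group inverse is \<open>Z - e d\<^sup>T\<close>, where \<open>Z = (I - P + e d\<^sup>T)\<^sup>-\<^sup>1\<close> is the fundamental matrix.\<close>

lemma (in unichain_matrix) mult_group_inv:
  "(mat 1 - P) ** group_inv (mat 1 - P) = mat 1 - (\<chi> x. stat_dist P)"
proof -
  define A where "A = mat 1 - P"
  define d where "d = stat_dist P"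
  \<comment> \<open>The matrix with all rows equal to \<open>d\<close>: a projection that commutes
    with \<open>P\<close>.\<close>
  define L :: "real ^ 'a ^ 'a" where "L = (\<chi> x. d)"
  have d: "(\<Sum>x\<in>UNIV. d $ x) = 1" "d v* P = d"
    using stationary_stat_dist by (auto simp: d_def)
  have PL: "P ** L = L"
    by (simp add: L_def matrix_matrix_mult_def vec_eq_iff row_sum flip: sum_distrib_right)
  have LP: "L ** P = L"
    using d(2) by (simp add: L_def matrix_matrix_mult_def vector_matrix_mult_def vec_eq_iff mult.commute)
  have LL: "L ** L = L"
    using d(1) by (simp add: L_def matrix_matrix_mult_def vec_eq_iff flip: sum_distrib_right)
  have AL: "A ** L = 0" and LA: "L ** A = 0"
    by (simp_all add: A_def matrix_diff_ldistrib matrix_diff_rdistrib PL LP)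
  \<comment> \<open>Pairing with \<open>d\<close> removes the \<open>A\<close> part and leaves
    \<open>d \<bullet> v = 0\<close>. Then \<open>v\<close> is harmonic, hence constant, and a
    constant of mean zero vanishes.\<close>
  have "v = 0" if "(A + L) *v v = 0" for v
  proof -
    have "L *v v = vec (d \<bullet> v)"
      by (simp add: L_def vec_eq_iff matrix_vector_mult_def inner_vec_def)
    with that have *: "v - P *v v + vec (d \<bullet> v) = 0"
      by (simp add: A_def matrix_vector_mult_add_rdistrib matrix_vector_mult_diff_rdistrib)
    then have dv: "d \<bullet> v = 0"
      using stationary_inner[OF stationary_stat_dist, of v "d \<bullet> v"] by (simp add: d_def)
    obtain x :: 'a where True by simp
    have "P *v v = v" using * dv by (simp add: vec_eq_iff)
    from harmonic_const[OF this, of x] obtain c where "v = vec c" by blast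
    with dv d(1) show "v = 0"
      by (simp add: inner_vec_def vec_eq_iff flip: sum_distrib_right)
  qed
  then obtain Z where ZW: "Z ** (A + L) = mat 1"
    using matrix_left_invertible_ker[of "A + L"] by auto
  then have WZ: "(A + L) ** Z = mat 1"
    by (simp add: matrix_left_right_inverse)
  have WL: "(A + L) ** L = L" and LW: "L ** (A + L) = L"
    by (simp_all add: matrix_add_ldistrib matrix_add_rdistrib AL LA LL)
  have ZL: "Z ** L = L"
    by (metis WL ZW matrix_mul_assoc matrix_mul_lid)
  have LZ: "L ** Z = L"
    by (metis LW WZ matrix_mul_assoc matrix_mul_rid)
  define D where "D = Z - L"
  have AD: "A ** D = mat 1 - L"
    using WZ LZ AL by (simp add: D_def matrix_diff_ldistrib matrix_add_rdistrib eq_diff_eq)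
  have DA: "D ** A = mat 1 - L"
    using ZW ZL LA by (simp add: D_def matrix_diff_rdistrib matrix_add_ldistrib eq_diff_eq)
  have DL: "D ** L = 0"
    by (simp add: D_def matrix_diff_rdistrib ZL LL)
  have LD: "L ** D = 0"
    by (simp add: D_def matrix_diff_ldistrib LZ LL)
  have "A ** D ** A = A" "D ** A ** D = D" "D ** A = A ** D"
    by (simp_all add: AD DA matrix_diff_rdistrib LA LD)
  then have "group_inv A = D"
    unfolding group_inv_def by (intro the_equality) (auto intro: group_inverse_unique)
  with AD show ?thesis by (simp add: A_def L_def d_def)
qed

text \<open>A crude operator bound, serving to bound the set in \<open>erg_coeff\<close>.\<close>

lemma norm1_vector_matrix_le:
  fixes A :: "real ^ 'x ^ 'x::finite"
  shows "norm1 (v v* A) \<le> norm1 v * (\<Sum>i\<in>UNIV. \<Sum>j\<in>UNIV. \<bar>A $ j $ i\<bar>)"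
proof -
  have "\<bar>v $ j\<bar> \<le> norm1 v" for j
    unfolding norm1_def by (auto intro: member_le_sum[of j UNIV "\<lambda>i. \<bar>v $ i\<bar>"])
  then have "\<bar>A $ j $ i * v $ j\<bar> \<le> norm1 v * \<bar>A $ j $ i\<bar>" for i j
    by (simp add: abs_mult mult.commute mult_right_mono)
  then have "\<bar>(v v* A) $ i\<bar> \<le> (\<Sum>j\<in>UNIV. norm1 v * \<bar>A $ j $ i\<bar>)" for i
    unfolding vector_matrix_mult_def
    by (auto intro!: order_trans[OF sum_abs] sum_mono simp: mult.commute)
  then show ?thesis
    unfolding norm1_def[of "v v* A"] sum_distrib_left by (intro sum_mono) simp
qed

lemma norm1_scaleR: "norm1 (c *\<^sub>R v) = \<bar>c\<bar> * norm1 v"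
  by (simp add: norm1_def abs_mult sum_distrib_left)

lemma norm1_eq_0_iff: "norm1 v = 0 \<longleftrightarrow> v = 0"
  by (simp add: norm1_def sum_nonneg_eq_0_iff vec_eq_iff)

lemma norm1_nonneg: "0 \<le> norm1 v"
  by (simp add: norm1_def sum_nonneg)

lemma bdd_above_erg_coeff:
  fixes A :: "real ^ 'x ^ 'x::finite"
  shows "bdd_above (insert 0 {norm1 (transpose A *v v) | v. norm1 v = 1 \<and> (\<Sum>i\<in>UNIV. v $ i) = 0})"
proof -
  have "bdd_above {norm1 (transpose A *v v) | v. norm1 v = 1 \<and> (\<Sum>i\<in>UNIV. v $ i) = 0}"
  proof (rule bdd_aboveI)
    fix r assume "r \<in> {norm1 (transpose A *v v) | v. norm1 v = 1 \<and> (\<Sum>i\<in>UNIV. v $ i) = 0}"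
    then obtain v where "r = norm1 (transpose A *v v)" "norm1 v = 1" by blast
    with norm1_vector_matrix_le[of v A] show "r \<le> (\<Sum>i\<in>UNIV. \<Sum>j\<in>UNIV. \<bar>A $ j $ i\<bar>)"
      by simp
  qed
  then show ?thesis by simp
qed

lemma erg_coeff_nonneg: "0 \<le> erg_coeff A"
  unfolding erg_coeff_def by (intro cSup_upper bdd_above_erg_coeff) simp

text \<open>Scaling reduces to norm one, where the supremum applies; \<open>u v* A\<close> is the
  transpose of \<open>A\<close> applied to \<open>u\<close>. The vector \<open>u = 0\<close> is
  treated apart since it cannot be normalized.\<close>

lemma norm1_mult_le_erg_coeff:
  assumes "(\<Sum>i\<in>UNIV. u $ i) = 0"
  shows "norm1 (u v* A) \<le> erg_coeff A * norm1 u"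
proof (cases "u = 0")
  case True
  then show ?thesis by (simp add: norm1_def)
next
  case False
  then have pos: "0 < norm1 u" using norm1_eq_0_iff norm1_nonneg by (metis order_le_less)
  define v where "v = (1 / norm1 u) *\<^sub>R u"
  have "norm1 v = 1" "(\<Sum>i\<in>UNIV. v $ i) = 0"
    using pos assms by (simp_all add: v_def norm1_scaleR flip: sum_divide_distrib)
  then have "norm1 (transpose A *v v) \<le> erg_coeff A"
    unfolding erg_coeff_def by (intro cSup_upper bdd_above_erg_coeff) blast
  moreover have "transpose A *v v = (1 / norm1 u) *\<^sub>R (u v* A)"
    unfolding v_def by (simp add: matrix_vector_mult_scaleR)
  ultimately show ?thesis using pos by (simp add: norm1_scaleR field_simps)
qed

text \<open>Multiply \<open>d\<^sub>1 (I - P\<^sub>2) = d\<^sub>1 (P\<^sub>1 - P\<^sub>2)\<close> by the group inverse of \<open>I - P\<^sub>2\<close>.\<close>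

lemma stat_dist_perturbation:
  assumes "unichain_matrix P\<^sub>1" "unichain_matrix P\<^sub>2"
  shows "stat_dist P\<^sub>2 - stat_dist P\<^sub>1 =
    (stat_dist P\<^sub>1 v* (P\<^sub>2 - P\<^sub>1)) v* group_inv (mat 1 - P\<^sub>2)"
proof -
  interpret P1: unichain_matrix P\<^sub>1 by fact
  interpret P2: unichain_matrix P\<^sub>2 by fact
  define d where "d = stat_dist P\<^sub>1"
  define D where "D = group_inv (mat 1 - P\<^sub>2)"
  have d: "(\<Sum>x\<in>UNIV. d $ x) = 1" "d v* P\<^sub>1 = d"
    using P1.stationary_stat_dist by (auto simp: d_def)
  \<comment> \<open>Stationarity replaces \<open>d v* P\<^sub>1\<close> by \<open>d\<close>.\<close>
  have "d v* (P\<^sub>2 - P\<^sub>1) = - (d v* (mat 1 - P\<^sub>2))"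
    using d(2) by (simp add: vector_matrix_left_distrib vector_matrix_mult_diff_rdistrib)
  then have "(d v* (P\<^sub>2 - P\<^sub>1)) v* D = - (d v* ((mat 1 - P\<^sub>2) ** D))"
    by (simp only: vector_matrix_uminus vector_matrix_mul_assoc)
  also have "\<dots> = - d + d v* (\<chi> x. stat_dist P\<^sub>2)"
    unfolding D_def P2.mult_group_inv vector_matrix_mult_diff_rdistrib vector_matrix_mul_rid by simp
  also have "d v* (\<chi> x. stat_dist P\<^sub>2) = stat_dist P\<^sub>2"
    using d(1) by (simp add: vector_matrix_mult_def vec_eq_iff flip: sum_distrib_right)
  finally show ?thesis by (simp add: d_def D_def)
qed

section \<open>Integration\<close>

text \<open>The tower rule for signed functions. \<open>nn_integral_bind\<close> handles the
  positive and the negative part, and finiteness comes from the iterated integral of the absolute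
  value.\<close>

lemma has_bochner_integral_bind:
  fixes f :: "'b \<Rightarrow> real"
  assumes K [measurable]: "K \<in> measurable M (subprob_algebra N)"
    and f [measurable]: "f \<in> borel_measurable N"
    and int: "\<And>x. x \<in> space M \<Longrightarrow> integrable (K x) f"
    and abs: "integrable M (\<lambda>x. \<integral>y. \<bar>f y\<bar> \<partial>K x)"
    and ne: "space M \<noteq> {}"
  shows "has_bochner_integral (M \<bind> K) f (\<integral>x. (\<integral>y. f y \<partial>K x) \<partial>M)"
proof -
  \<comment> \<open>Stated for any nonnegative \<open>g\<close> below the absolute value of
    \<open>f\<close>, so that both parts of \<open>f\<close> are instances.\<close>
  have nonneg: "has_bochner_integral (M \<bind> K) g (\<integral>x. (\<integral>y. g y \<partial>K x) \<partial>M)"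
      and nonneg_int: "integrable M (\<lambda>x. \<integral>y. g y \<partial>K x)"
    if g [measurable]: "g \<in> borel_measurable N" and g0: "\<And>y. 0 \<le> g y" and le: "\<And>y. g y \<le> \<bar>f y\<bar>"
    for g :: "'b \<Rightarrow> real"
  proof -
    have "sets (M \<bind> K) = sets N"
      by (rule sets_bind[OF sets_kernel[OF K] ne])
    from measurable_cong_sets[OF this refl] g
    have gMK: "g \<in> borel_measurable (M \<bind> K)"
      by blast
    have gK: "integrable (K x) g" if x: "x \<in> space M" for x
    proof (rule Bochner_Integration.integrable_bound[OF integrable_abs[OF int[OF x]]])
      show "g \<in> borel_measurable (K x)"
        using measurable_cong_sets[OF sets_kernel[OF K x] refl] g by blast
      show "AE y in K x. norm (g y) \<le> norm \<bar>f y\<bar>"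
        using g0 le by simp
    qed
    show gM: "integrable M (\<lambda>x. \<integral>y. g y \<partial>K x)"
    proof (rule Bochner_Integration.integrable_bound[OF abs])
      show "(\<lambda>x. \<integral>y. g y \<partial>K x) \<in> borel_measurable M"
        by measurable
      show "AE x in M. norm (\<integral>y. g y \<partial>K x) \<le> norm (\<integral>y. \<bar>f y\<bar> \<partial>K x)"
      proof (rule AE_I2)
        fix x assume x: "x \<in> space M"
        have "(\<integral>y. g y \<partial>K x) \<le> (\<integral>y. \<bar>f y\<bar> \<partial>K x)"
          by (intro integral_mono gK x integrable_abs int le)
        then show "norm (\<integral>y. g y \<partial>K x) \<le> norm (\<integral>y. \<bar>f y\<bar> \<partial>K x)"
          using g0 by (simp add: integral_nonneg_AE)
      qed
    qed
    have "(\<integral>\<^sup>+ y. ennreal (g y) \<partial>(M \<bind> K)) = (\<integral>\<^sup>+ x. (\<integral>\<^sup>+ y. ennreal (g y) \<partial>K x) \<partial>M)"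
      by (rule nn_integral_bind[OF _ K]) measurable
    also have "\<dots> = (\<integral>\<^sup>+ x. ennreal (\<integral>y. g y \<partial>K x) \<partial>M)"
      using g0 by (intro nn_integral_cong nn_integral_eq_integral gK) auto
    also have "\<dots> = ennreal (\<integral>x. (\<integral>y. g y \<partial>K x) \<partial>M)"
      using g0 by (intro nn_integral_eq_integral gM) (auto intro: integral_nonneg_AE)
    finally show "has_bochner_integral (M \<bind> K) g (\<integral>x. (\<integral>y. g y \<partial>K x) \<partial>M)"
      using g0 gMK by (intro has_bochner_integral_nn_integral) (auto intro!: integral_nonneg_AE)
  qed
  let ?p = "\<lambda>y. max (f y) 0" and ?n = "\<lambda>y. max (- f y) 0"
  have pn: "f y = ?p y - ?n y" for y by simp
  have "has_bochner_integral (M \<bind> K) (\<lambda>y. ?p y - ?n y)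
      ((\<integral>x. (\<integral>y. ?p y \<partial>K x) \<partial>M) - (\<integral>x. (\<integral>y. ?n y \<partial>K x) \<partial>M))"
    by (intro has_bochner_integral_diff nonneg) auto
  also have "(\<integral>x. (\<integral>y. ?p y \<partial>K x) \<partial>M) - (\<integral>x. (\<integral>y. ?n y \<partial>K x) \<partial>M) =
      (\<integral>x. (\<integral>y. ?p y \<partial>K x) - (\<integral>y. ?n y \<partial>K x) \<partial>M)"
    by (intro Bochner_Integration.integral_diff[symmetric] nonneg_int) auto
  also have "\<dots> = (\<integral>x. (\<integral>y. ?p y - ?n y \<partial>K x) \<partial>M)"
    by (intro Bochner_Integration.integral_cong refl Bochner_Integration.integral_diff[symmetric]
        integrable_max int integrable_minus) auto
  finally show ?thesis by (simp add: pn[symmetric])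
qed

text \<open>Layer-cake formula: \<open>X w\<close> is the length of the set of \<open>s\<close> with
  \<open>0 \<le> s\<close> and \<open>s < X w\<close>, and Tonelli swaps the integrals. It
  identifies \<open>mean_time\<close>, defined through the distribution function, with the expected
  sojourn.\<close>

lemma (in prob_space) has_bochner_integral_tail:
  fixes X :: "'a \<Rightarrow> real"
  assumes X [measurable]: "X \<in> borel_measurable M"
    and nonneg: "AE w in M. 0 \<le> X w"
    and int: "set_integrable lborel {0..} (\<lambda>s. 1 - prob {w \<in> space M. X w \<le> s})"
  shows "has_bochner_integral M X (LINT s:{0..}|lborel. 1 - prob {w \<in> space M. X w \<le> s})"
proof (rule has_bochner_integral_nn_integral[OF X nonneg])
  let ?F = "\<lambda>s. prob {w \<in> space M. X w \<le> s}"
  interpret pair_sigma_finite lborel M ..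
  have tail: "emeasure M {w \<in> space M. s < X w} = ennreal (1 - ?F s)" for s
  proof -
    have "{w \<in> space M. s < X w} = space M - {w \<in> space M. X w \<le> s}" by auto
    then show ?thesis by (simp add: emeasure_eq_measure prob_compl)
  qed
  show "0 \<le> (LINT s:{0..}|lborel. 1 - ?F s)"
    unfolding set_lebesgue_integral_def by (intro integral_nonneg_AE) auto
  have "(\<integral>\<^sup>+ w. ennreal (X w) \<partial>M) = (\<integral>\<^sup>+ w. (\<integral>\<^sup>+ s. indicator {s. 0 \<le> s \<and> s < X w} s \<partial>lborel) \<partial>M)"
  proof (rule nn_integral_cong_AE, use nonneg in eventually_elim)
    fix w assume "0 \<le> X w"
    moreover have "{s. 0 \<le> s \<and> s < X w} = {0..<X w}" by auto
    ultimately show "ennreal (X w) = (\<integral>\<^sup>+ s. indicator {s. 0 \<le> s \<and> s < X w} s \<partial>lborel)"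
      by simp
  qed
  also have "\<dots> = (\<integral>\<^sup>+ s. (\<integral>\<^sup>+ w. indicator {s. 0 \<le> s \<and> s < X w} s \<partial>M) \<partial>lborel)"
  proof (rule Fubini')
    have "(\<lambda>(s, w). indicator {s. 0 \<le> s \<and> s < X w} s) =
        (\<lambda>p. if 0 \<le> fst p \<and> fst p < X (snd p) then 1 else 0 :: ennreal)"
      by (auto simp: fun_eq_iff)
    then show "(\<lambda>(s, w). indicator {s. 0 \<le> s \<and> s < X w} s) \<in>
        borel_measurable (lborel \<Otimes>\<^sub>M M)"
      by simp
  qed
  also have "\<dots> = (\<integral>\<^sup>+ s. ennreal (indicator {0..} s *\<^sub>R (1 - ?F s)) \<partial>lborel)"
  proof (rule nn_integral_cong)
    fix s :: real
    have "(\<integral>\<^sup>+ w. indicator {s. 0 \<le> s \<and> s < X w} s \<partial>M) =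
        (\<integral>\<^sup>+ w. indicator {0..} s * indicator {w \<in> space M. s < X w} w \<partial>M)"
      by (intro nn_integral_cong) (auto split: split_indicator)
    also have "\<dots> = indicator {0..} s * emeasure M {w \<in> space M. s < X w}"
      by (rule nn_integral_cmult_indicator) measurable
    finally show "(\<integral>\<^sup>+ w. indicator {s. 0 \<le> s \<and> s < X w} s \<partial>M) =
        ennreal (indicator {0..} s *\<^sub>R (1 - ?F s))"
      unfolding tail by (simp split: split_indicator)
  qed
  also have "\<dots> = ennreal (LINT s:{0..}|lborel. 1 - ?F s)"
    unfolding set_lebesgue_integral_def
    by (rule nn_integral_eq_integral) (use int in \<open>auto simp: set_integrable_def\<close>)
  finally show "(\<integral>\<^sup>+ w. ennreal (X w) \<partial>M) = ennreal (LINT s:{0..}|lborel. 1 - ?F s)" .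
qed

section \<open>Expectations along a trajectory\<close>

text \<open>The inner kernel of \<open>epoch_law\<close>, named so that integration over the cycle
  and over the action can be separated.\<close>

definition cycle_epoch :: "('x, 'a, 'w) smdp \<Rightarrow> 'x \<Rightarrow> 'a \<Rightarrow> ('x, 'a) epoch measure" where
  "cycle_epoch S x a = distr (cycle_law S x a) epoch_space (\<lambda>w. (x, a, sojourn S w, next_state S w))"

locale semi_markov =
  fixes S :: "('x::finite, 'a, 'w) smdp"
  assumes smdp: "is_smdp S"
begin

lemma prob_space_cycle_law: "prob_space (cycle_law S x a)"
  and measurable_sojourn [measurable]: "sojourn S \<in> borel_measurable (cycle_law S x a)"
  and sojourn_nonneg: "AE w in cycle_law S x a. 0 \<le> sojourn S w"
  using smdp by (auto simp: is_smdp_def)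

lemma measurable_next_state [measurable]:
  "next_state S \<in> measurable (cycle_law S x a) (count_space UNIV)"
proof -
  have "(\<lambda>(t, w). nat_proc S t w) \<in> measurable (borel \<Otimes>\<^sub>M cycle_law S x a) (count_space UNIV)"
    using smdp by (auto simp: is_smdp_def)
  moreover have "(\<lambda>w. (sojourn S w, w)) \<in> measurable (cycle_law S x a) (borel \<Otimes>\<^sub>M cycle_law S x a)"
    by measurable
  ultimately show ?thesis
    using measurable_compose by (fastforce simp: next_state_def[abs_def])
qed

lemma measurable_cycle_epoch [measurable]:
  "(\<lambda>w. (x, a, sojourn S w, next_state S w)) \<in> measurable (cycle_law S x a) epoch_space"
  unfolding epoch_space_def by measurable

lemma cycle_epoch_in_prob_algebra: "cycle_epoch S x a \<in> space (prob_algebra epoch_space)"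
  unfolding cycle_epoch_def
  by (auto simp: space_prob_algebra intro!: prob_space.prob_space_distr prob_space_cycle_law)

lemma measurable_cycle_epoch_kernel:
  "cycle_epoch S x \<in> measurable (measure_pmf p) (subprob_algebra epoch_space)"
  using cycle_epoch_in_prob_algebra[of x]
  by (auto simp: space_prob_algebra space_subprob_algebra prob_space_imp_subprob_space)

lemma epoch_law_in_subprob_algebra: "epoch_law S \<pi> \<mu> \<in> space (subprob_algebra epoch_space)"
  by (rule prob_space_epoch_law(1)[OF smdp])

lemma epoch_law_eq_bind:
  "epoch_law S \<pi> \<mu> = measure_pmf \<mu> \<bind> (\<lambda>x. measure_pmf (\<pi> x) \<bind> cycle_epoch S x)"
  by (simp add: epoch_law_def cycle_epoch_def[abs_def])

lemma epoch_law_return: "epoch_law S \<pi> (return_pmf x) = measure_pmf (\<pi> x) \<bind> cycle_epoch S x"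
proof -
  have "measure_pmf (\<pi> x) \<bind> cycle_epoch S x \<in> space (prob_algebra epoch_space)" for x
    by (intro bind_measure_pmf_in_prob_algebra cycle_epoch_in_prob_algebra)
  then have "(\<lambda>x. measure_pmf (\<pi> x) \<bind> cycle_epoch S x) \<in>
      measurable (count_space UNIV) (subprob_algebra epoch_space)"
    by (auto simp: space_prob_algebra space_subprob_algebra prob_space_imp_subprob_space)
  then show ?thesis
    unfolding epoch_law_eq_bind return_pmf.rep_eq by (simp add: bind_return)
qed

text \<open>Disintegration by the initial state, which reduces an arbitrary \<open>\<mu>\<close> to
  fixed starting states.\<close>

lemma epoch_law_bind: "epoch_law S \<pi> \<mu> = measure_pmf \<mu> \<bind> (\<lambda>x. epoch_law S \<pi> (return_pmf x))"
  by (simp add: epoch_law_return epoch_law_eq_bind[of \<pi> \<mu>])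

lemma has_bochner_integral_sojourn:
  "has_bochner_integral (cycle_law S x a) (sojourn S) (mean_time S x a)"
proof -
  interpret prob_space "cycle_law S x a" by (rule prob_space_cycle_law)
  have "set_integrable lborel {0..} (\<lambda>s. 1 - epoch_cdf S s x a)"
    using smdp by (auto simp: is_smdp_def)
  then show ?thesis
    using has_bochner_integral_tail[OF measurable_sojourn sojourn_nonneg]
    by (simp add: mean_time_def epoch_cdf_def)
qed

text \<open>Markov's inequality: the sojourn exceeds \<open>\<delta>\<close> with probability at
  least \<open>\<epsilon>\<close>, uniformly in state and action, so
  \<open>\<delta> * \<epsilon>\<close> is a lower bound.\<close>

lemma mean_time_bounded_below:
  obtains c where "0 < c" "\<And>x a. c \<le> mean_time S x a"
proof -
  obtain \<epsilon> \<delta> where pos: "\<epsilon> > 0" "\<delta> > 0" and le: "\<And>x a. epoch_cdf S \<delta> x a \<le> 1 - \<epsilon>"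
    using smdp by (auto simp: is_smdp_def)
  have "\<delta> * \<epsilon> \<le> mean_time S x a" for x a
  proof -
    interpret prob_space "cycle_law S x a" by (rule prob_space_cycle_law)
    let ?A = "{w \<in> space (cycle_law S x a). \<delta> < sojourn S w}"
    have "?A = space (cycle_law S x a) - {w \<in> space (cycle_law S x a). sojourn S w \<le> \<delta>}" by auto
    then have "prob ?A = 1 - epoch_cdf S \<delta> x a"
      by (simp add: prob_compl epoch_cdf_def)
    with le[of x a] pos have "\<delta> * \<epsilon> \<le> \<delta> * prob ?A" by simp
    also have "\<dots> = (\<integral>w. \<delta> * indicator ?A w \<partial>cycle_law S x a)"
      by simp
    also have "\<dots> \<le> (\<integral>w. sojourn S w \<partial>cycle_law S x a)"
    proof (rule integral_mono_AE)
      show "integrable (cycle_law S x a) (\<lambda>w. \<delta> * indicator ?A w)"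
        by (intro integrable_mult_right integrable_real_indicator) (auto simp: emeasure_eq_measure)
      show "integrable (cycle_law S x a) (sojourn S)"
        using has_bochner_integral_sojourn by (auto simp: has_bochner_integral_iff)
      show "AE w in cycle_law S x a. \<delta> * indicator ?A w \<le> sojourn S w"
        using sojourn_nonneg by eventually_elim (auto split: split_indicator)
    qed
    also have "\<dots> = mean_time S x a"
      using has_bochner_integral_sojourn by (auto simp: has_bochner_integral_iff)
    finally show ?thesis .
  qed
  with pos show ?thesis by (intro that[of "\<delta> * \<epsilon>"]) auto
qed

text \<open>The tower rule over the action, followed by the image measure of the cycle. The
  condition \<open>abs\<close> controls the average over a possibly infinite action set.\<close>

lemma has_bochner_integral_epoch_law:
  fixes f :: "('x, 'a) epoch \<Rightarrow> real"
  assumes f: "f \<in> borel_measurable epoch_space"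
    and int: "\<And>a. integrable (cycle_law S x a) (\<lambda>w. f (x, a, sojourn S w, next_state S w))"
    and abs: "integrable (measure_pmf (\<pi> x))
      (\<lambda>a. \<integral>w. \<bar>f (x, a, sojourn S w, next_state S w)\<bar> \<partial>cycle_law S x a)"
  shows "has_bochner_integral (epoch_law S \<pi> (return_pmf x)) f
    (measure_pmf.expectation (\<pi> x) (\<lambda>a. \<integral>w. f (x, a, sojourn S w, next_state S w) \<partial>cycle_law S x a))"
proof -
  have eq: "(\<integral>e. h e \<partial>cycle_epoch S x a) = (\<integral>w. h (x, a, sojourn S w, next_state S w) \<partial>cycle_law S x a)"
    if "h \<in> borel_measurable epoch_space" for h :: "('x, 'a) epoch \<Rightarrow> real" and a
    unfolding cycle_epoch_def by (rule integral_distr) (use that in auto)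
  have "integrable (cycle_epoch S x a) f" for a
    unfolding cycle_epoch_def by (subst integrable_distr_eq) (use f int in auto)
  moreover have "integrable (measure_pmf (\<pi> x)) (\<lambda>a. \<integral>e. \<bar>f e\<bar> \<partial>cycle_epoch S x a)"
    using abs f by (subst eq) auto
  ultimately show ?thesis
    unfolding epoch_law_return
    using has_bochner_integral_bind[OF measurable_cycle_epoch_kernel f, of "\<pi> x" x] f
    by (simp add: eq)
qed

text \<open>With finitely many states, \<open>G (next_state S w)\<close> is a finite combination of
  indicators, so integrability is automatic.\<close>

lemma has_bochner_integral_next_state:
  "has_bochner_integral (cycle_law S x a) (\<lambda>w. G (next_state S w)) (\<Sum>y\<in>UNIV. next_prob S x a y * G y)"
  for G :: "'x \<Rightarrow> real"
proof -
  interpret prob_space "cycle_law S x a" by (rule prob_space_cycle_law)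
  let ?A = "\<lambda>y. {w \<in> space (cycle_law S x a). next_state S w = y}"
  have "has_bochner_integral (cycle_law S x a) (\<lambda>w. \<Sum>y\<in>UNIV. indicator (?A y) w * G y)
      (\<Sum>y\<in>UNIV. prob (?A y) * G y)"
    by (intro has_bochner_integral_sum has_bochner_integral_mult_left has_bochner_integral_real_indicator)
      (auto simp: emeasure_eq_measure)
  moreover have "(\<Sum>y\<in>UNIV. indicator (?A y) w * G y) = G (next_state S w)"
    if "w \<in> space (cycle_law S x a)" for w
    using that by (simp add: indicator_def if_distrib[of "\<lambda>r. r * _"] sum.delta cong: if_cong)
  ultimately show ?thesis
    unfolding next_prob_def by (subst (asm) has_bochner_integral_cong) auto
qed

lemma sum_next_prob: "(\<Sum>y\<in>UNIV. next_prob S x a y) = 1"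
proof -
  interpret prob_space "cycle_law S x a" by (rule prob_space_cycle_law)
  show ?thesis
    using has_bochner_integral_integral_eq[OF has_bochner_integral_next_state[of x a "\<lambda>_. 1"]]
    by (simp add: prob_space)
qed

lemma integrable_next_prob: "integrable (measure_pmf p) (\<lambda>a. next_prob S x a y)"
proof (rule measure_pmf.integrable_const_bound[where B = 1])
  show "AE a in measure_pmf p. norm (next_prob S x a y) \<le> 1"
    using prob_space.prob_le_1[OF prob_space_cycle_law] by (auto simp: next_prob_def)
qed simp

lemma expectation_next_prob:
  "measure_pmf.expectation (\<pi> x) (\<lambda>a. \<Sum>y\<in>UNIV. next_prob S x a y * G y) =
    (trans_mat S \<pi> *v (\<chi> y. G y)) $ x"
  by (simp add: matrix_vector_mult_def trans_mat_def integrable_next_prob)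

lemma stochastic_matrix_trans_mat: "stochastic_matrix (trans_mat S \<pi>)"
proof
  show "0 \<le> trans_mat S \<pi> $ x $ y" for x y
    by (simp add: trans_mat_def next_prob_def)
  show "(\<Sum>y\<in>UNIV. trans_mat S \<pi> $ x $ y) = 1" for x
    using expectation_next_prob[of \<pi> x "\<lambda>_. 1"] by (simp add: matrix_vector_mult_def sum_next_prob)
qed

lemma measurable_epoch_components [measurable]:
  "fst \<in> measurable epoch_space (count_space UNIV)"
  "(\<lambda>e. fst (snd e)) \<in> measurable epoch_space (count_space UNIV)"
  "(\<lambda>e. fst (snd (snd e))) \<in> borel_measurable epoch_space"
  "(\<lambda>e. snd (snd (snd e))) \<in> measurable epoch_space (count_space UNIV)"
  unfolding epoch_space_def by measurable

text \<open>One epoch acts on functions of its final state as \<open>trans_mat\<close>; this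
  produces the matrix powers along a trajectory.\<close>

lemma has_bochner_integral_epoch_law_next:
  fixes G :: "'x \<Rightarrow> real"
  shows "has_bochner_integral (epoch_law S \<pi> (return_pmf x)) (\<lambda>e. G (snd (snd (snd e))))
    ((trans_mat S \<pi> *v (\<chi> y. G y)) $ x)"
proof -
  have int: "integrable (cycle_law S x a) (\<lambda>w. H (next_state S w))"
    and eq: "(\<integral>w. H (next_state S w) \<partial>cycle_law S x a) = (\<Sum>y\<in>UNIV. next_prob S x a y * H y)"
    for H :: "'x \<Rightarrow> real" and a
    using has_bochner_integral_next_state[of x a H] by (auto simp: has_bochner_integral_iff)
  have "(\<lambda>e. G (snd (snd (snd e)))) \<in> borel_measurable (epoch_space :: ('x, 'a) epoch measure)"
    by (rule measurable_compose[OF measurable_epoch_components(4)]) simp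
  from has_bochner_integral_epoch_law[OF this, of x \<pi>] show ?thesis
    using eq[where H = "\<lambda>y. \<bar>G y\<bar>"]
    by (simp add: int eq integrable_next_prob expectation_next_prob)
qed

section \<open>Laws of single epochs under the trajectory measure\<close>

abbreviation "epoch_kernel_pmf \<pi> e \<equiv> epoch_law S \<pi> (return_pmf (snd (snd (snd e))))"

text \<open>The projective limit has the finite-stage measures \<open>IT.C 0 n\<close> as marginals.
  Each stage appends a coordinate drawn from \<open>epoch_kernel\<close>, which after the start
  depends only on the state ending the previous epoch; hence the Markov recursion.\<close>

lemma distr_traj_law_0: "distr (traj_law S \<pi> \<mu>) epoch_space (\<lambda>\<omega>. \<omega> 0) = epoch_law S \<pi> \<mu>"
  and distr_traj_law_Suc: "distr (traj_law S \<pi> \<mu>) epoch_space (\<lambda>\<omega>. \<omega> (Suc k)) =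
    distr (traj_law S \<pi> \<mu>) epoch_space (\<lambda>\<omega>. \<omega> k) \<bind> epoch_kernel_pmf \<pi>"
proof -
  interpret IT: Ionescu_Tulcea "epoch_kernel S \<pi> \<mu>" "\<lambda>_. epoch_space"
    by (rule Ionescu_Tulcea_epoch_kernel[OF smdp])
  let ?PM = "\<lambda>n::nat. PiM {0..<n} (\<lambda>_. epoch_space :: ('x, 'a) epoch measure)"
  \<comment> \<open>The only element of the product over the empty index set, where the construction
    starts.\<close>
  let ?u = "\<lambda>_::nat. undefined :: ('x, 'a) epoch"
  have u: "?u \<in> space (?PM 0)" by simp
  have setsC: "sets (IT.C 0 n ?u) = sets (?PM n)" for n
    using IT.sets_C[OF u, of n] by simp
  have spaceC: "space (IT.C 0 n ?u) = space (?PM n)" for n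
    using IT.space_C[OF u, of n] by simp
  have neC: "space (?PM n) \<noteq> {}" for n
    using prob_space.not_empty[OF IT.prob_space_C[OF u, of n]] spaceC by simp
  have comp: "(\<lambda>\<omega>. \<omega> n) \<in> measurable (?PM (Suc n)) epoch_space" for n
    by (rule measurable_component_singleton) simp
  have C: "distr (traj_law S \<pi> \<mu>) (?PM n) (\<lambda>\<omega>. restrict \<omega> {0..<n}) = IT.C 0 n ?u" for n
  proof -
    \<comment> \<open>\<open>IT.CI\<close> runs the construction to the first stage covering the
      index set; for \<open>{0..<n}\<close> this is stage \<open>n\<close>, also when
      \<open>n\<close> is zero.\<close>
    have up: "IT.up_to {0..<n} = n"
    proof (rule antisym)
      show "IT.up_to {0..<n} \<le> n" by (simp add: IT.up_to_iff)
      show "n \<le> IT.up_to {0..<n}"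
        using IT.up_to_less[of "{0..<n}" "n - 1"] by (cases n) auto
    qed
    show ?thesis
      unfolding traj_law_def using IT.distr_C[OF order_refl u, of n]
      by (simp add: IT.distr_lim IT.CI_def up)
  qed
  \<comment> \<open>Coordinate \<open>n\<close> is first present at stage
    \<open>Suc n\<close>.\<close>
  have distr: "distr (traj_law S \<pi> \<mu>) epoch_space (\<lambda>\<omega>. \<omega> n) =
      distr (IT.C 0 (Suc n) ?u) epoch_space (\<lambda>\<omega>. \<omega> n)" for n
    unfolding C[symmetric]
    by (subst distr_distr[OF comp])
      (auto simp: comp_def measurable_cong_sets[OF sets_traj_law[OF smdp] refl] intro!: measurable_restrict)
  have bind: "distr (traj_law S \<pi> \<mu>) epoch_space (\<lambda>\<omega>. \<omega> n) = IT.C 0 n ?u \<bind> epoch_kernel S \<pi> \<mu> n" for n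
  proof -
    have "distr (IT.C 0 n ?u \<bind> IT.eP n) epoch_space (\<lambda>\<omega>. \<omega> n) =
        IT.C 0 n ?u \<bind> (\<lambda>\<omega>. distr (IT.eP n \<omega>) epoch_space (\<lambda>\<omega>. \<omega> n))"
      using IT.measurable_eP[of n] neC[of n]
      by (intro distr_bind[OF _ _ comp]) (auto simp: spaceC measurable_cong_sets[OF setsC refl])
    also have "\<dots> = IT.C 0 n ?u \<bind> epoch_kernel S \<pi> \<mu> n"
    proof (intro bind_cong refl)
      fix \<omega> assume "\<omega> \<in> space (IT.C 0 n ?u)"
      then have \<omega>: "\<omega> \<in> space (?PM n)" by (simp add: spaceC)
      have upd: "fun_upd \<omega> n \<in> measurable (epoch_kernel S \<pi> \<mu> n \<omega>) (?PM (Suc n))"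
        using \<omega> by (intro measurable_fun_upd[where J = "{0..<n}"])
          (auto simp: measurable_cong_sets[OF IT.sets_P[OF \<omega>] refl])
      \<comment> \<open>\<open>IT.eP n\<close> writes a fresh draw into position \<open>n\<close>,
        so reading that position recovers the law of the draw.\<close>
      show "distr (IT.eP n \<omega>) epoch_space (\<lambda>\<omega>. \<omega> n) = epoch_kernel S \<pi> \<mu> n \<omega>"
        unfolding IT.eP_def by (simp add: distr_distr[OF comp upd] comp_def distr_id2 IT.sets_P[OF \<omega>])
    qed
    finally show ?thesis by (simp add: distr)
  qed
  show "distr (traj_law S \<pi> \<mu>) epoch_space (\<lambda>\<omega>. \<omega> 0) = epoch_law S \<pi> \<mu>"
    unfolding bind using bind_return[OF IT.P u] by simp
  have kernel: "epoch_kernel_pmf \<pi> \<in> measurable epoch_space (subprob_algebra epoch_space)"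
    by (rule measurable_compose[OF measurable_epoch_components(4)]) (use epoch_law_in_subprob_algebra in auto)
  have "epoch_kernel S \<pi> \<mu> (Suc k) = (\<lambda>\<omega>. epoch_kernel_pmf \<pi> (\<omega> k))"
    by (auto split: prod.splits)
  then show "distr (traj_law S \<pi> \<mu>) epoch_space (\<lambda>\<omega>. \<omega> (Suc k)) =
      distr (traj_law S \<pi> \<mu>) epoch_space (\<lambda>\<omega>. \<omega> k) \<bind> epoch_kernel_pmf \<pi>"
    unfolding bind[of "Suc k"] distr[of k]
    using bind_distr[OF _ kernel, of "\<lambda>\<omega>. \<omega> k" "IT.C 0 (Suc k) ?u"] comp[of k] neC[of "Suc k"]
    by (simp add: spaceC measurable_cong_sets[OF setsC refl] del: IT.C.simps)
qed

text \<open>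
  Integrating out epoch \<open>k + 1\<close> leaves a function of the state reached at the end of epoch \<open>k\<close>,
  to which the induction hypothesis applies with \<open>P F\<close> in place of \<open>F\<close>.
\<close>

lemma has_bochner_integral_epoch:
  fixes f :: "('x, 'a) epoch \<Rightarrow> real"
  assumes "f \<in> borel_measurable epoch_space"
    and "\<And>x. has_bochner_integral (epoch_law S \<pi> (return_pmf x)) f (F $ x)"
  shows "has_bochner_integral (traj_law S \<pi> \<mu>) (\<lambda>\<omega>. f (\<omega> k))
    (\<Sum>x\<in>UNIV. pmf \<mu> x * (((*v) (trans_mat S \<pi>) ^^ k) F) $ x)"
proof -
  have pm: "(\<lambda>\<omega>. \<omega> k) \<in> measurable (traj_law S \<pi> \<mu>) epoch_space" for k
    by (simp add: measurable_cong_sets[OF sets_traj_law[OF smdp] refl])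
  have "has_bochner_integral (distr (traj_law S \<pi> \<mu>) epoch_space (\<lambda>\<omega>. \<omega> k)) f
      (\<Sum>x\<in>UNIV. pmf \<mu> x * (((*v) (trans_mat S \<pi>) ^^ k) F) $ x)"
    using assms
  proof (induction k arbitrary: f F)
    case 0
    have "(\<lambda>x. epoch_law S \<pi> (return_pmf x)) \<in> measurable (measure_pmf \<mu>) (subprob_algebra epoch_space)"
      using epoch_law_in_subprob_algebra by auto
    from has_bochner_integral_bind[OF this 0(1)] show ?case
      unfolding distr_traj_law_0 epoch_law_bind[of \<pi> \<mu>] using 0(2)
      by (simp add: has_bochner_integral_iff integrable_measure_pmf_finite integral_measure_pmf[of UNIV])
  next
    case (Suc k)
    let ?D = "distr (traj_law S \<pi> \<mu>) epoch_space (\<lambda>\<omega>. \<omega> k)"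
    interpret D: prob_space ?D
      by (rule prob_space.prob_space_distr[OF prob_space_traj_law[OF smdp] pm])
    have IH: "has_bochner_integral ?D (\<lambda>e. G (snd (snd (snd e))))
        (\<Sum>x\<in>UNIV. pmf \<mu> x * (((*v) (trans_mat S \<pi>) ^^ k) (trans_mat S \<pi> *v (\<chi> y. G y))) $ x)"
      for G :: "'x \<Rightarrow> real"
      by (rule Suc.IH[OF measurable_compose[OF measurable_epoch_components(4)]
            has_bochner_integral_epoch_law_next]) simp
    have kernel: "epoch_kernel_pmf \<pi> \<in> measurable ?D (subprob_algebra epoch_space)"
      unfolding measurable_distr_eq1
      by (rule measurable_compose[OF measurable_epoch_components(4)])
        (use epoch_law_in_subprob_algebra in auto)
    \<comment> \<open>As a function of the end state this conditional expectation takes finitely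
      many values, so the induction hypothesis supplies its integrability.\<close>
    have "integrable ?D (\<lambda>e. \<integral>e'. \<bar>f e'\<bar> \<partial>epoch_kernel_pmf \<pi> e)"
      using IH[of "\<lambda>y. \<integral>e'. \<bar>f e'\<bar> \<partial>epoch_law S \<pi> (return_pmf y)"] by (simp add: has_bochner_integral_iff)
    from has_bochner_integral_bind[OF kernel Suc.prems(1) _ this D.not_empty] Suc.prems(2)
    have "has_bochner_integral (?D \<bind> epoch_kernel_pmf \<pi>) f (\<integral>e. F $ (snd (snd (snd e))) \<partial>?D)"
      by (simp add: has_bochner_integral_iff)
    also have "(\<integral>e. F $ (snd (snd (snd e))) \<partial>?D) =
        (\<Sum>x\<in>UNIV. pmf \<mu> x * (((*v) (trans_mat S \<pi>) ^^ Suc k) F) $ x)"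
      using has_bochner_integral_integral_eq[OF IH[of "($) F"]] by (simp add: funpow_swap1)
    finally show ?case by (simp only: distr_traj_law_Suc)
  qed
  then show ?thesis
    using assms(1) pm by (simp add: has_bochner_integral_iff integral_distr integrable_distr_eq)
qed

section \<open>Expected cost and expected duration of an epoch\<close>

lemma has_bochner_integral_cost:
  assumes "has_means S \<pi>"
  shows "has_bochner_integral (traj_law S \<pi> \<mu>) (\<lambda>\<omega>. epoch_cost S (state_at \<omega> k) (action_at \<omega> k))
    (\<Sum>x\<in>UNIV. pmf \<mu> x * (((*v) (trans_mat S \<pi>) ^^ k) (\<chi> x. pol_cost S \<pi> x)) $ x)"
  unfolding state_at_def action_at_def
proof (rule has_bochner_integral_epoch)
  \<comment> \<open>The state serves as the countable index because the action type may be
    uncountable, where functions of the pair are not automatically measurable.\<close>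
  show m: "(\<lambda>e. epoch_cost S (fst e) (fst (snd e))) \<in> borel_measurable epoch_space"
    by (rule measurable_compose_countable[OF measurable_compose[OF measurable_epoch_components(2)]
          measurable_epoch_components(1)]) simp
  fix x
  interpret prob_space "cycle_law S x a" for a by (rule prob_space_cycle_law)
  show "has_bochner_integral (epoch_law S \<pi> (return_pmf x)) (\<lambda>e. epoch_cost S (fst e) (fst (snd e)))
      ((\<chi> x. pol_cost S \<pi> x) $ x)"
    using has_bochner_integral_epoch_law[OF m, of x \<pi>] assms
    by (simp add: prob_space has_means_def pol_cost_def)
qed

lemma has_bochner_integral_time:
  assumes "has_means S \<pi>"
  shows "has_bochner_integral (traj_law S \<pi> \<mu>) (\<lambda>\<omega>. time_at \<omega> k)
    (\<Sum>x\<in>UNIV. pmf \<mu> x * (((*v) (trans_mat S \<pi>) ^^ k) (\<chi> x. pol_time S \<pi> x)) $ x)"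
  unfolding time_at_def
proof (rule has_bochner_integral_epoch[OF measurable_epoch_components(3)])
  fix x
  have int: "integrable (cycle_law S x a) (sojourn S)"
    and eq: "(\<integral>w. sojourn S w \<partial>cycle_law S x a) = mean_time S x a" for a
    using has_bochner_integral_sojourn by (auto simp: has_bochner_integral_iff)
  have "(\<integral>w. \<bar>sojourn S w\<bar> \<partial>cycle_law S x a) = mean_time S x a" for a
    unfolding eq[symmetric] by (rule integral_cong_AE) (use sojourn_nonneg[of x a] in auto)
  then show "has_bochner_integral (epoch_law S \<pi> (return_pmf x)) (\<lambda>e. fst (snd (snd e)))
      ((\<chi> x. pol_time S \<pi> x) $ x)"
    using has_bochner_integral_epoch_law[OF measurable_epoch_components(3), of x \<pi>] assms int
    by (simp add: eq has_means_def pol_time_def)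
qed

end

section \<open>Average cost and performance difference\<close>

context semi_markov
begin

text \<open>The expectation is a mixture over \<open>\<mu>\<close> of Cesaro averages from fixed
  states. These all have the same limit, so the mixture does too.\<close>

lemma average_expectation_limit:
  assumes "unichain (trans_mat S \<pi>)"
    and X: "\<And>k. has_bochner_integral (traj_law S \<pi> \<mu>) (X k)
      (\<Sum>x\<in>UNIV. pmf \<mu> x * (((*v) (trans_mat S \<pi>) ^^ k) F) $ x)"
  shows "(\<lambda>N. (LINT \<omega>|traj_law S \<pi> \<mu>. (\<Sum>k\<le>N. X k \<omega>)) / real (Suc N))
    \<longlonglongrightarrow> stat_dist (trans_mat S \<pi>) \<bullet> F"
proof -
  interpret P: stochastic_matrix "trans_mat S \<pi>" by (rule stochastic_matrix_trans_mat)
  interpret P: unichain_matrix "trans_mat S \<pi>" by unfold_locales fact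
  let ?a = "\<lambda>N x. (\<Sum>k\<le>N. (((*v) (trans_mat S \<pi>) ^^ k) F) $ x) / real (Suc N)"
  have "(LINT \<omega>|traj_law S \<pi> \<mu>. (\<Sum>k\<le>N. X k \<omega>)) =
      (\<Sum>k\<le>N. \<Sum>x\<in>UNIV. pmf \<mu> x * (((*v) (trans_mat S \<pi>) ^^ k) F) $ x)" for N
    by (intro has_bochner_integral_integral_eq has_bochner_integral_sum X)
  then have "(LINT \<omega>|traj_law S \<pi> \<mu>. (\<Sum>k\<le>N. X k \<omega>)) / real (Suc N) =
      (\<Sum>x\<in>UNIV. pmf \<mu> x * ?a N x)" for N
    by (subst (asm) sum.swap) (simp add: sum_distrib_left sum_divide_distrib)
  moreover have "(\<lambda>N. \<Sum>x\<in>UNIV. pmf \<mu> x * ?a N x) \<longlonglongrightarrow>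
      (\<Sum>x\<in>UNIV. pmf \<mu> x * (stat_dist (trans_mat S \<pi>) \<bullet> F))"
    by (intro tendsto_sum tendsto_mult_left P.cesaro_limit)
  moreover have "(\<Sum>x\<in>UNIV. pmf \<mu> x * (stat_dist (trans_mat S \<pi>) \<bullet> F)) = stat_dist (trans_mat S \<pi>) \<bullet> F"
    by (simp add: sum_pmf_eq_1 flip: sum_distrib_right)
  ultimately show ?thesis by simp
qed

lemma mean_epoch_eq: "mean_epoch S \<pi> = stat_dist (trans_mat S \<pi>) \<bullet> (\<chi> x. pol_time S \<pi> x)"
  by (simp add: mean_epoch_def inner_vec_def)

text \<open>The uniform lower bound on \<open>mean_time\<close> survives averaging over actions and
  over the stationary distribution.\<close>

lemma mean_epoch_pos:
  assumes "unichain (trans_mat S \<pi>)" "has_means S \<pi>"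
  shows "0 < mean_epoch S \<pi>"
proof -
  interpret P: stochastic_matrix "trans_mat S \<pi>" by (rule stochastic_matrix_trans_mat)
  interpret P: unichain_matrix "trans_mat S \<pi>" by unfold_locales fact
  obtain c where c: "0 < c" "\<And>x a. c \<le> mean_time S x a" by (rule mean_time_bounded_below) blast
  have "c \<le> pol_time S \<pi> x" for x
    unfolding pol_time_def using assms(2) c(2)
    by (intro measure_pmf.integral_ge_const) (auto simp: has_means_def)
  then have "(\<Sum>x\<in>UNIV. stat_dist (trans_mat S \<pi>) $ x * c) \<le> mean_epoch S \<pi>"
    unfolding mean_epoch_def using P.stationary_stat_dist by (intro sum_mono mult_left_mono) auto
  then show ?thesis
    using c(1) P.stationary_stat_dist by (simp flip: sum_distrib_right)
qed

text \<open>Numerator and denominator are divided by \<open>Suc N\<close> and converge separately,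
  the latter to a positive number. Uniqueness of limits then resolves the description operator in
  \<open>avg_cost\<close>.\<close>

lemma avg_cost_eq:
  assumes "unichain (trans_mat S \<pi>)" "has_means S \<pi>"
  shows "avg_cost S \<pi> = stat_dist (trans_mat S \<pi>) \<bullet> (\<chi> x. pol_cost S \<pi> x) / mean_epoch S \<pi>"
    (is "_ = ?\<eta>")
proof -
  let ?ratio = "\<lambda>\<mu> N.
     (LINT \<omega>|traj_law S \<pi> \<mu>. (\<Sum>k\<le>N. epoch_cost S (state_at \<omega> k) (action_at \<omega> k))) /
     (LINT \<omega>|traj_law S \<pi> \<mu>. (\<Sum>k\<le>N. time_at \<omega> k))"
  have lim: "?ratio \<mu> \<longlonglongrightarrow> ?\<eta>" for \<mu>
  proof -
    have "(\<lambda>N. ((LINT \<omega>|traj_law S \<pi> \<mu>. (\<Sum>k\<le>N. epoch_cost S (state_at \<omega> k) (action_at \<omega> k))) / real (Suc N)) /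
        ((LINT \<omega>|traj_law S \<pi> \<mu>. (\<Sum>k\<le>N. time_at \<omega> k)) / real (Suc N))) \<longlonglongrightarrow> ?\<eta>"
      unfolding mean_epoch_eq
      by (intro tendsto_divide average_expectation_limit assms
          has_bochner_integral_cost has_bochner_integral_time)
        (use mean_epoch_pos[OF assms] in \<open>simp add: mean_epoch_eq\<close>)
    then show ?thesis by (simp del: of_nat_Suc)
  qed
  then show ?thesis
    unfolding avg_cost_def by (intro the_equality) (auto dest: LIMSEQ_unique)
qed

lemma expectation_advantage:
  assumes "has_means S \<pi>"
  shows "measure_pmf.expectation (\<pi> x) (advantage S \<pi>' x) =
    pol_cost S \<pi> x - avg_cost S \<pi>' * pol_time S \<pi> x +
      ((trans_mat S \<pi> *v (\<chi> y. rel_value S \<pi>' y)) $ x - rel_value S \<pi>' x)"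
  using assms
  by (simp add: advantage_def[abs_def] has_means_def pol_cost_def pol_time_def integrable_next_prob
      flip: expectation_next_prob)

text \<open>
  Stationarity of \<open>d\<^sub>\<pi>\<close> makes the relative values cancel, whatever they are.
\<close>

lemma performance_difference:
  assumes "unichain (trans_mat S \<pi>)" "has_means S \<pi>"
  shows "(avg_cost S \<pi> - avg_cost S \<pi>') * mean_epoch S \<pi> =
    (\<Sum>x\<in>UNIV. stat_dist (trans_mat S \<pi>) $ x * measure_pmf.expectation (\<pi> x) (advantage S \<pi>' x))"
proof -
  interpret P: stochastic_matrix "trans_mat S \<pi>" by (rule stochastic_matrix_trans_mat)
  interpret P: unichain_matrix "trans_mat S \<pi>" by unfold_locales fact
  let ?d = "stat_dist (trans_mat S \<pi>)" and ?h = "\<chi> y. rel_value S \<pi>' y"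
  \<comment> \<open>The summand \<open>vec 0\<close> brings the relative-value part into the form of
    \<open>stationary_inner\<close> with constant zero.\<close>
  have "(\<Sum>x\<in>UNIV. ?d $ x * measure_pmf.expectation (\<pi> x) (advantage S \<pi>' x)) =
      ?d \<bullet> ((\<chi> x. pol_cost S \<pi> x) - avg_cost S \<pi>' *\<^sub>R (\<chi> x. pol_time S \<pi> x) -
        (?h - trans_mat S \<pi> *v ?h + vec 0))"
    by (simp add: expectation_advantage[OF assms(2)] inner_vec_def algebra_simps)
  also have "\<dots> = ?d \<bullet> (\<chi> x. pol_cost S \<pi> x) - avg_cost S \<pi>' * mean_epoch S \<pi>"
    unfolding inner_diff_right P.stationary_inner[OF P.stationary_stat_dist] mean_epoch_eq by simp
  also have "?d \<bullet> (\<chi> x. pol_cost S \<pi> x) = avg_cost S \<pi> * mean_epoch S \<pi>"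
    using mean_epoch_pos[OF assms] by (simp add: avg_cost_eq[OF assms])
  finally show ?thesis by (simp add: algebra_simps)
qed

text \<open>In each row the triangle inequality is applied under the sum over actions; summing over
  next states then removes \<open>next_prob\<close>, leaving the 1-norm of the difference of the
  action laws.\<close>

lemma norm1_trans_mat_diff_le:
  assumes d: "\<And>x. 0 \<le> d $ x"
  shows "norm1 (d v* (trans_mat S \<pi> - trans_mat S \<pi>')) \<le> 2 * (\<Sum>x\<in>UNIV. d $ x * tv_dist (\<pi> x) (\<pi>' x))"
proof -
  have row: "(\<Sum>y\<in>UNIV. \<bar>(trans_mat S \<pi> - trans_mat S \<pi>') $ x $ y\<bar>) \<le> 2 * tv_dist (\<pi> x) (\<pi>' x)" for x
  proof -
    let ?q = "\<lambda>a. pmf (\<pi> x) a - pmf (\<pi>' x) a"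
    let ?np = "\<lambda>y a. next_prob S x a y"
    have np0: "0 \<le> ?np y a" for y a by (simp add: next_prob_def)
    \<comment> \<open>Both policies become densities against the counting measure, so that their
      expectations can be subtracted under one integral.\<close>
    have npi: "integrable (count_space UNIV) (\<lambda>a. pmf p a * ?np y a)" for p y
      using integrable_next_prob[of p x y] by (simp add: measure_pmf_eq_density integrable_density)
    have qi: "integrable (count_space UNIV) (\<lambda>a. \<bar>?q a\<bar>)"
      by (intro integrable_abs Bochner_Integration.integrable_diff integrable_pmf)
    have qnp: "integrable (count_space UNIV) (\<lambda>a. ?q a * ?np y a)" for y
      using Bochner_Integration.integrable_diff[OF npi npi] by (simp add: left_diff_distrib)
    then have qnp_abs: "integrable (count_space UNIV) (\<lambda>a. \<bar>?q a\<bar> * ?np y a)" for y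
      using integrable_abs[OF qnp[of y]] np0 by (simp add: abs_mult)
    have "(trans_mat S \<pi> - trans_mat S \<pi>') $ x $ y = (\<integral>a. ?q a * ?np y a \<partial>count_space UNIV)" for y
      using Bochner_Integration.integral_diff[OF npi[of "\<pi> x" y] npi[of "\<pi>' x" y]]
      by (simp add: trans_mat_def measure_pmf_eq_density integral_density left_diff_distrib)
    then have "\<bar>(trans_mat S \<pi> - trans_mat S \<pi>') $ x $ y\<bar> \<le> (\<integral>a. \<bar>?q a\<bar> * ?np y a \<partial>count_space UNIV)" for y
      using integral_norm_bound[of "count_space UNIV" "\<lambda>a. ?q a * ?np y a"] np0
      by (simp add: abs_mult)
    then have "(\<Sum>y\<in>UNIV. \<bar>(trans_mat S \<pi> - trans_mat S \<pi>') $ x $ y\<bar>) \<le>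
        (\<Sum>y\<in>UNIV. \<integral>a. \<bar>?q a\<bar> * ?np y a \<partial>count_space UNIV)"
      by (rule sum_mono)
    also have "\<dots> = (\<integral>a. (\<Sum>y\<in>UNIV. \<bar>?q a\<bar> * ?np y a) \<partial>count_space UNIV)"
      by (rule Bochner_Integration.integral_sum[symmetric]) (rule qnp_abs)
    also have "\<dots> = (\<integral>a. \<bar>?q a\<bar> \<partial>count_space UNIV)"
      by (simp add: sum_next_prob flip: sum_distrib_left)
    also have "\<dots> = (\<Sum>\<^sub>\<infinity>a. \<bar>?q a\<bar>)"
      using qi by (simp add: infsetsum_infsum[symmetric] infsetsum_def abs_summable_on_def
          flip: abs_summable_equivalent)
    finally show ?thesis by (simp add: tv_dist_def)
  qed
  have "norm1 (d v* (trans_mat S \<pi> - trans_mat S \<pi>')) \<le>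
      (\<Sum>y\<in>UNIV. \<Sum>x\<in>UNIV. d $ x * \<bar>(trans_mat S \<pi> - trans_mat S \<pi>') $ x $ y\<bar>)"
    unfolding norm1_def vector_matrix_mult_def using d
    by (auto intro!: sum_mono order_trans[OF sum_abs] simp: abs_mult)
  also have "\<dots> = (\<Sum>x\<in>UNIV. d $ x * (\<Sum>y\<in>UNIV. \<bar>(trans_mat S \<pi> - trans_mat S \<pi>') $ x $ y\<bar>))"
    by (subst sum.swap) (simp add: sum_distrib_left)
  also have "\<dots> \<le> (\<Sum>x\<in>UNIV. d $ x * (2 * tv_dist (\<pi> x) (\<pi>' x)))"
    by (intro sum_mono mult_left_mono row d)
  finally show ?thesis by (simp add: sum_distrib_left mult.left_commute)
qed

end

section \<open>Importance weights and the cost bound\<close>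

lemma expectation_importance_ratio:
  fixes f :: "'a \<Rightarrow> real"
  assumes "set_pmf q \<subseteq> set_pmf p"
  shows "measure_pmf.expectation p (\<lambda>a. pmf q a / pmf p a * f a) = measure_pmf.expectation q f"
proof -
  \<comment> \<open>Where \<open>p\<close> has no mass the left side is zero, and the support
    inclusion makes \<open>q\<close> vanish there as well.\<close>
  have "pmf p a * (pmf q a / pmf p a * f a) = pmf q a * f a" for a
    using assms by (cases "pmf p a = 0") (auto simp: pmf_eq_0_set_pmf)
  then show ?thesis
    by (simp add: measure_pmf_eq_density integral_density)
qed

theorem theorem5:
  fixes S :: "('x::finite, 'a, 'w) smdp" and \<pi>\<^sub>1 \<pi>\<^sub>2 :: "('x, 'a) policy"
  assumes smdp: "is_smdp S"
    and unichain: "\<And>\<pi>. unichain (trans_mat S \<pi>)"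
    and means: "has_means S \<pi>\<^sub>1" "has_means S \<pi>\<^sub>2"
    and series: "\<And>x. summable (rel_term S \<pi>\<^sub>1 x)"
    and ratio: "\<And>x. stat_dist (trans_mat S \<pi>\<^sub>1) $ x > 0 \<Longrightarrow> set_pmf (\<pi>\<^sub>2 x) \<subseteq> set_pmf (\<pi>\<^sub>1 x)"
  shows "avg_cost S \<pi>\<^sub>2 - avg_cost S \<pi>\<^sub>1 \<le>
      1 / mean_epoch S \<pi>\<^sub>2 *
        (\<Sum>x\<in>UNIV. stat_dist (trans_mat S \<pi>\<^sub>1) $ x *
           measure_pmf.expectation (\<pi>\<^sub>1 x)
             (\<lambda>a. pmf (\<pi>\<^sub>2 x) a / pmf (\<pi>\<^sub>1 x) a * advantage S \<pi>\<^sub>1 x a)) +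
      2 * eps_coeff S \<pi>\<^sub>1 \<pi>\<^sub>2 * erg_coeff (group_inv (mat 1 - trans_mat S \<pi>\<^sub>2)) *
        (\<Sum>x\<in>UNIV. stat_dist (trans_mat S \<pi>\<^sub>1) $ x * tv_dist (\<pi>\<^sub>2 x) (\<pi>\<^sub>1 x))"
proof -
  interpret semi_markov S by standard (rule smdp)
  have uni: "unichain_matrix (trans_mat S \<pi>)" for \<pi>
    using stochastic_matrix_trans_mat[of \<pi>] unichain[of \<pi>]
    by (simp add: unichain_matrix_def unichain_matrix_axioms_def)
  interpret P1: unichain_matrix "trans_mat S \<pi>\<^sub>1" by (rule uni)
  interpret P2: unichain_matrix "trans_mat S \<pi>\<^sub>2" by (rule uni)
  define d1 where "d1 = stat_dist (trans_mat S \<pi>\<^sub>1)"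
  define d2 where "d2 = stat_dist (trans_mat S \<pi>\<^sub>2)"
  define m where "m = mean_epoch S \<pi>\<^sub>2"
  define B where "B x = measure_pmf.expectation (\<pi>\<^sub>2 x) (advantage S \<pi>\<^sub>1 x)" for x
  define b where "b = Max (range (\<lambda>x. \<bar>B x\<bar>))"
  define \<tau> where "\<tau> = erg_coeff (group_inv (mat 1 - trans_mat S \<pi>\<^sub>2))"
  define T where "T = (\<Sum>x\<in>UNIV. d1 $ x * tv_dist (\<pi>\<^sub>2 x) (\<pi>\<^sub>1 x))"
  let ?u = "d1 v* (trans_mat S \<pi>\<^sub>2 - trans_mat S \<pi>\<^sub>1)"
  have m: "0 < m" unfolding m_def by (rule mean_epoch_pos[OF unichain means(2)])
  have d1: "0 \<le> d1 $ x" for x using P1.stationary_stat_dist by (simp add: d1_def)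
  have b: "\<bar>B x\<bar> \<le> b" for x by (simp add: b_def)
  then have b0: "0 \<le> b" by (rule order_trans[OF abs_ge_zero])
  have \<tau>: "0 \<le> \<tau>" unfolding \<tau>_def by (rule erg_coeff_nonneg)
  \<comment> \<open>Both transition matrices fix \<open>vec 1\<close>, so their difference sends it
    to zero.\<close>
  have "(\<Sum>i\<in>UNIV. ?u $ i) = 0"
  proof -
    have "?u \<bullet> vec 1 = 0"
      by (simp only: dot_lmul_matrix matrix_vector_mult_diff_rdistrib P1.mult_const P2.mult_const
          diff_self inner_zero_right)
    then show ?thesis by (simp add: inner_vec_def)
  qed
  from norm1_mult_le_erg_coeff[OF this]
  have "norm1 (d2 - d1) \<le> \<tau> * norm1 ?u"
    unfolding d1_def d2_def \<tau>_def stat_dist_perturbation[OF uni uni] .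
  also have "\<dots> \<le> \<tau> * (2 * T)"
    unfolding T_def by (intro mult_left_mono norm1_trans_mat_diff_le d1 \<tau>)
  finally have diff: "norm1 (d2 - d1) \<le> 2 * \<tau> * T" by simp
  have "(avg_cost S \<pi>\<^sub>2 - avg_cost S \<pi>\<^sub>1) * m = (\<Sum>x\<in>UNIV. d2 $ x * B x)"
    unfolding m_def d2_def B_def by (rule performance_difference[OF unichain means(2)])
  also have "\<dots> = (\<Sum>x\<in>UNIV. d1 $ x * B x) + (\<Sum>x\<in>UNIV. (d2 - d1) $ x * B x)"
    by (simp add: algebra_simps sum_subtractf)
  also have "(\<Sum>x\<in>UNIV. (d2 - d1) $ x * B x) \<le> (\<Sum>x\<in>UNIV. \<bar>(d2 - d1) $ x\<bar> * b)"
  proof (rule sum_mono)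
    fix x
    have "(d2 - d1) $ x * B x \<le> \<bar>(d2 - d1) $ x\<bar> * \<bar>B x\<bar>"
      unfolding abs_mult[symmetric] by (rule abs_ge_self)
    also have "\<dots> \<le> \<bar>(d2 - d1) $ x\<bar> * b"
      by (intro mult_left_mono b) simp
    finally show "(d2 - d1) $ x * B x \<le> \<bar>(d2 - d1) $ x\<bar> * b" .
  qed
  also have "\<dots> = norm1 (d2 - d1) * b"
    by (simp add: norm1_def sum_distrib_right)
  also have "\<dots> \<le> 2 * \<tau> * T * b"
    by (rule mult_right_mono[OF diff b0])
  finally have "avg_cost S \<pi>\<^sub>2 - avg_cost S \<pi>\<^sub>1 \<le> ((\<Sum>x\<in>UNIV. d1 $ x * B x) + 2 * \<tau> * T * b) / m"
    using m by (simp add: pos_le_divide_eq)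
  also have "\<dots> = 1 / m * (\<Sum>x\<in>UNIV. d1 $ x * B x) + 2 * (1 / m * b) * \<tau> * T"
    using m by (simp add: field_simps)
  also have "(\<Sum>x\<in>UNIV. d1 $ x * B x) = (\<Sum>x\<in>UNIV. d1 $ x *
      measure_pmf.expectation (\<pi>\<^sub>1 x) (\<lambda>a. pmf (\<pi>\<^sub>2 x) a / pmf (\<pi>\<^sub>1 x) a * advantage S \<pi>\<^sub>1 x a))"
  proof (rule sum.cong[OF refl])
    fix x
    show "d1 $ x * B x = d1 $ x *
        measure_pmf.expectation (\<pi>\<^sub>1 x) (\<lambda>a. pmf (\<pi>\<^sub>2 x) a / pmf (\<pi>\<^sub>1 x) a * advantage S \<pi>\<^sub>1 x a)"
    \<comment> \<open>The support inclusion is given where \<open>d1\<close> has mass; elsewhere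
      both sides are zero.\<close>
    proof (cases "d1 $ x = 0")
      case False
      with d1[of x] have "set_pmf (\<pi>\<^sub>2 x) \<subseteq> set_pmf (\<pi>\<^sub>1 x)"
        by (intro ratio) (simp add: d1_def)
      then show ?thesis by (simp only: expectation_importance_ratio B_def)
    qed simp
  qed
  also have "1 / m * b = eps_coeff S \<pi>\<^sub>1 \<pi>\<^sub>2"
    by (simp add: eps_coeff_def m_def b_def B_def)
  finally show ?thesis by (simp only: m_def d1_def \<tau>_def T_def)
qed

end
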